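(* Let $\alpha,\beta,\widetilde\alpha,\widetilde\beta>-1$. The Jacobi weight $w_{\alpha,\beta}(x)=(1-x)^\alpha(1+x)^\beta$ on $(-1,1)$ is a Darboux transformation of the Jacobi weight $w_{\widetilde\alpha,\widetilde\beta}(x)=(1-x)^{\widetilde\alpha}(1+x)^{\widetilde\beta}$ on $(-1,1)$ if and only if $$\alpha+\beta=\widetilde\alpha+\widetilde\beta\quad\text{and}\quad \alpha-\widetilde\alpha\in\mathbb Z.$$
   Context: Differential operators $D=\sum_{j}\partial^jf_j(x)$ with $f_j\in\mathbb C[x]$, $\partial=\frac{d}{dx}$, act on the right on functions: $p(x)\cdot D=\sum_j p^{(j)}(x)f_j(x)$; products satisfy $p\cdot(D_1D_2)=(p\cdot D_1)\cdot D_2$. The algebra of these operators is denoted $\Omega[x]$. For a scalar weight $w$ on an interval (positive almost everywhere, smooth, with finite moments) with monic orthogonal polynomials $p_n$, $\mathcal D(w)$ is the algebra of all $D\in\Omega[x]$ such that for every $n\ge 0$, $p_n\cdot D=\Lambda_n(D)p_n$ for some $\Lambda_n(D)\in\mathbb C$. An operator $\mathcal V\in\Omega[x]$ is degree-preserving if $\deg(p\cdot\mathcal V)=\deg p$ for all $p\in\mathbb C[x]$. For scalar weights $w,\widetilde w$ on the same interval with monic orthogonal polynomials $p_n,\widetilde p_n$, $\widetilde w$ is a Darboux transformation of $w$ if there is $D\in\mathcal D(w)$ with $D=\mathcal V\mathcal N$, where $\mathcal V,\mathcal N\in\Omega[x]$ are degree-preserving and $p_n\cdot\mathcal V=A_n\widetilde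 p_n$ for all $n\in\mathbb N_0$, for some $A_n\in\mathbb C$. *)

theory Defs
  imports "HOL-Analysis.Analysis" "HOL-Computational_Algebra.Polynomial"
begin

text \<open>
  A differential operator \<open>D = \<Sum>j. \<partial>^j f_j(x)\<close> in \<open>\<Omega>[x]\<close> is represented by
  the polynomial whose \<open>j\<close>-th coefficient is \<open>f_j\<close>. It acts on the right,
  \<open>p \<cdot> D = \<Sum>j. p^(j) f_j\<close>: first differentiate, then multiply by \<open>f_j\<close>.
\<close>

type_synonym diff_op = "complex poly poly"

definition op_act :: "complex poly \<Rightarrow> diff_op \<Rightarrow> complex poly" where
  "op_act p D = (\<Sum>j\<le>degree D. (pderiv ^^ j) p * coeff D j)"

text \<open>
  The product of \<open>\<Omega>[x]\<close>, given by the Leibniz rule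
  \<open>(\<partial>^i f)(\<partial>^j g) = \<Sum>k\<le>j. (j choose k) \<partial>^(i+k) f^(j-k) g\<close>.
  It is not the (commutative) multiplication of \<^typ>\<open>complex poly poly\<close>.
\<close>

definition op_mult :: "diff_op \<Rightarrow> diff_op \<Rightarrow> diff_op" where
  "op_mult D E =
     (\<Sum>i\<le>degree D. \<Sum>j\<le>degree E. \<Sum>k\<le>j.
        monom (of_nat (j choose k) * (pderiv ^^ (j - k)) (coeff D i) * coeff E j) (i + k))"

lemma higher_pderiv_mult:
  "(pderiv ^^ n) (p * q) =
     (\<Sum>k\<le>n. of_nat (n choose k) * (pderiv ^^ k) p * (pderiv ^^ (n - k)) (q :: complex poly))"
proof (induction n)
  case 0
  then show ?case by simp
next
  case (Suc n)
  define t where "t a b = (pderiv ^^ a) p * (pderiv ^^ b) q" for a b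
  have pd: "pderiv (of_nat c * (pderiv ^^ a) p * (pderiv ^^ b) q)
      = of_nat c * t (Suc a) b + of_nat c * t a (Suc b)" for a b c
  proof -
    have "pderiv (of_nat c :: complex poly) = 0"
      by (simp add: of_nat_poly pderiv_pCons)
    then show ?thesis
      by (simp add: t_def pderiv_mult algebra_simps)
  qed
  have "(pderiv ^^ Suc n) (p * q) =
      (\<Sum>k\<le>n. of_nat (n choose k) * t (Suc k) (n - k)) + (\<Sum>k\<le>n. of_nat (n choose k) * t k (Suc (n - k)))"
    by (simp add: Suc.IH higher_pderiv_sum[of 1, simplified] pd sum.distrib)
  also have "(\<Sum>k\<le>n. of_nat (n choose k) * t k (Suc (n - k)))
      = (\<Sum>k\<le>Suc n. of_nat (n choose k) * t k (Suc n - k))"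
    by (simp add: Suc_diff_le)
  also have "\<dots> = t 0 (Suc n) + (\<Sum>k\<le>n. of_nat (n choose Suc k) * t (Suc k) (n - k))"
    by (subst sum.atMost_Suc_shift) simp
  also have "(\<Sum>k\<le>n. of_nat (n choose k) * t (Suc k) (n - k)) + \<dots>
      = t 0 (Suc n) + (\<Sum>k\<le>n. of_nat (Suc n choose Suc k) * t (Suc k) (n - k))"
    by (simp add: sum.distrib algebra_simps)
  also have "\<dots> = (\<Sum>k\<le>Suc n. of_nat (Suc n choose k) * t k (Suc n - k))"
    by (subst sum.atMost_Suc_shift) simp
  finally show ?case by (simp add: t_def mult.assoc)
qed

lemma op_act_bound:
  "degree D \<le> n \<Longrightarrow> op_act p D = (\<Sum>j\<le>n. (pderiv ^^ j) p * coeff D j)"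
  unfolding op_act_def by (rule sum.mono_neutral_left) (auto simp: coeff_eq_0)

lemma op_act_add: "op_act p (D + E) = op_act p D + op_act p E"
proof -
  define n where "n = max (degree D) (degree E)"
  have "degree D \<le> n" "degree E \<le> n" "degree (D + E) \<le> n"
    by (auto simp: n_def degree_add_le_max)
  then show ?thesis
    by (simp add: op_act_bound algebra_simps sum.distrib)
qed

lemma op_act_0 [simp]: "op_act p 0 = 0"
  by (simp add: op_act_def)

lemma op_act_sum: "op_act p (\<Sum>i\<in>A. F i) = (\<Sum>i\<in>A. op_act p (F i))"
  by (induction A rule: infinite_finite_induct) (simp_all add: op_act_add)

lemma op_act_monom: "op_act p (monom f j) = (pderiv ^^ j) p * f"
proof -
  have "op_act p (monom f j) = (\<Sum>i\<le>j. (pderiv ^^ i) p * coeff (monom f j) i)"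
    by (rule op_act_bound) (rule degree_monom_le)
  also have "\<dots> = (\<Sum>i\<le>j. if i = j then (pderiv ^^ i) p * f else 0)"
    by (rule sum.cong) auto
  finally show ?thesis by simp
qed

lemma op_act_mult: "op_act p (op_mult D E) = op_act (op_act p D) E"
proof -
  have "op_act p (op_mult D E) =
      (\<Sum>i\<le>degree D. \<Sum>j\<le>degree E. \<Sum>k\<le>j. (pderiv ^^ (i + k)) p *
         (of_nat (j choose k) * (pderiv ^^ (j - k)) (coeff D i) * coeff E j))"
    by (simp add: op_mult_def op_act_sum op_act_monom)
  also have "\<dots> = (\<Sum>i\<le>degree D. \<Sum>j\<le>degree E.
      (pderiv ^^ j) ((pderiv ^^ i) p * coeff D i) * coeff E j)"
  proof (intro sum.cong refl)
    fix i j
    have "(pderiv ^^ k) ((pderiv ^^ i) p) = (pderiv ^^ (i + k)) p" for k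
      by (metis add.commute comp_apply funpow_add)
    then show "(\<Sum>k\<le>j. (pderiv ^^ (i + k)) p *
         (of_nat (j choose k) * (pderiv ^^ (j - k)) (coeff D i) * coeff E j)) =
      (pderiv ^^ j) ((pderiv ^^ i) p * coeff D i) * coeff E j"
      unfolding higher_pderiv_mult sum_distrib_right
      by (intro sum.cong refl) (simp add: mult_ac)
  qed
  also have "\<dots> = op_act (op_act p D) E"
    by (subst sum.swap) (simp add: op_act_def higher_pderiv_sum sum_distrib_right)
  finally show ?thesis .
qed

text \<open>
  Here \<open>deg 0 = -\<infinity>\<close>, whereas \<^term>\<open>degree 0 = 0\<close>; hence nonzero constants must be
  explicitly required to stay nonzero.
\<close>

definition degree_preserving :: "diff_op \<Rightarrow> bool" where
  "degree_preserving V \<longleftrightarrow> (\<forall>p. p \<noteq> 0 \<longrightarrow> op_act p V \<noteq> 0 \<and> degree (op_act p V) = degree p)"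

definition smooth_on_open :: "real set \<Rightarrow> (real \<Rightarrow> real) \<Rightarrow> bool" where
  "smooth_on_open I w \<longleftrightarrow> (\<forall>k. (deriv ^^ k) w differentiable_on I)"

text \<open>The interval is taken open (possibly unbounded) and nonempty.\<close>

definition scalar_weight :: "real set \<Rightarrow> (real \<Rightarrow> real) \<Rightarrow> bool" where
  "scalar_weight I w \<longleftrightarrow>
     open I \<and> is_interval I \<and> I \<noteq> {} \<and>
     (AE x in lborel. x \<in> I \<longrightarrow> w x > 0) \<and>
     smooth_on_open I w \<and>
     (\<forall>n. set_integrable lborel I (\<lambda>x. x ^ n * w x))"

definition weight_inner ::
    "real set \<Rightarrow> (real \<Rightarrow> real) \<Rightarrow> complex poly \<Rightarrow> complex poly \<Rightarrow> complex" where
  "weight_inner I w p q =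
     (LINT x:I|lborel. poly p (of_real x) * cnj (poly q (of_real x)) * of_real (w x))"

definition is_monic_ops ::
    "real set \<Rightarrow> (real \<Rightarrow> real) \<Rightarrow> (nat \<Rightarrow> complex poly) \<Rightarrow> bool" where
  "is_monic_ops I w p \<longleftrightarrow>
     (\<forall>n. degree (p n) = n \<and> lead_coeff (p n) = 1) \<and>
     (\<forall>m n. m \<noteq> n \<longrightarrow> weight_inner I w (p m) (p n) = 0)"

text \<open>For a scalar weight this sequence exists and is unique, by Gram--Schmidt.\<close>

definition monic_ops :: "real set \<Rightarrow> (real \<Rightarrow> real) \<Rightarrow> nat \<Rightarrow> complex poly" where
  "monic_ops I w = (THE p. is_monic_ops I w p)"

definition op_algebra :: "real set \<Rightarrow> (real \<Rightarrow> real) \<Rightarrow> diff_op set" where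
  "op_algebra I w =
     {D. \<forall>n. \<exists>\<Lambda>. op_act (monic_ops I w n) D = smult \<Lambda> (monic_ops I w n)}"

text \<open>The second weight \<open>w'\<close> is a Darboux transformation of the first weight \<open>w\<close>.\<close>

definition darboux_transformation ::
    "real set \<Rightarrow> (real \<Rightarrow> real) \<Rightarrow> (real \<Rightarrow> real) \<Rightarrow> bool" where
  "darboux_transformation I w w' \<longleftrightarrow>
     scalar_weight I w \<and> scalar_weight I w' \<and>
     (\<exists>D \<in> op_algebra I w. \<exists>V N.
        D = op_mult V N \<and> degree_preserving V \<and> degree_preserving N \<and>
        (\<forall>n. \<exists>A. op_act (monic_ops I w n) V = smult A (monic_ops I w' n)))"

definition jacobi_weight :: "real \<Rightarrow> real \<Rightarrow> real \<Rightarrow> real" where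
  "jacobi_weight \<alpha> \<beta> x = (1 - x) powr \<alpha> * (1 + x) powr \<beta>"

lemma smooth_jacobi_weight: "smooth_on_open {-1<..<1} (jacobi_weight \<alpha> \<beta>)"
proof -
  define g where "g k q x = poly q x * ((1 - x) powr (\<alpha> - real k) * (1 + x) powr (\<beta> - real k))"
    for k :: nat and q :: "real poly" and x :: real
  define d where "d k q = pderiv q * [:1, 0, -1:] - smult (\<alpha> - real k) (q * [:1, 1:])
      + smult (\<beta> - real k) (q * [:1, -1:])" for k :: nat and q :: "real poly"
  have g': "(g k q has_field_derivative g (Suc k) (d k q) x) (at x)"
    if x: "x \<in> {-1<..<1}" for k q x
  proof -
    have e: "(1 - x) powr (\<alpha> - real k) = (1 - x) * (1 - x) powr (\<alpha> - real (Suc k))"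
            "(1 + x) powr (\<beta> - real k) = (1 + x) * (1 + x) powr (\<beta> - real (Suc k))"
      using x powr_mult_base[of "1 - x" "\<alpha> - real (Suc k)"]
        powr_mult_base[of "1 + x" "\<beta> - real (Suc k)"] by simp_all
    have e': "\<alpha> - real k - 1 = \<alpha> - real (Suc k)" "\<beta> - real k - 1 = \<beta> - real (Suc k)"
      by simp_all
    have "(g k q has_field_derivative
        poly (pderiv q) x * ((1 - x) powr (\<alpha> - real k) * (1 + x) powr (\<beta> - real k)) +
        poly q x * (- (\<alpha> - real k) * (1 - x) powr (\<alpha> - real (Suc k)) * (1 + x) powr (\<beta> - real k)
          + (1 - x) powr (\<alpha> - real k) * ((\<beta> - real k) * (1 + x) powr (\<beta> - real (Suc k))))) (at x)"
      unfolding g_def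
      by (rule derivative_eq_intros refl poly_DERIV | use x in \<open>simp add: e' algebra_simps\<close>)+
    also have "poly (pderiv q) x * ((1 - x) powr (\<alpha> - real k) * (1 + x) powr (\<beta> - real k)) +
        poly q x * (- (\<alpha> - real k) * (1 - x) powr (\<alpha> - real (Suc k)) * (1 + x) powr (\<beta> - real k)
          + (1 - x) powr (\<alpha> - real k) * ((\<beta> - real k) * (1 + x) powr (\<beta> - real (Suc k))))
        = g (Suc k) (d k q) x"
      unfolding e g_def d_def by (simp add: algebra_simps)
    finally show ?thesis .
  qed
  have *: "\<exists>q. \<forall>x\<in>{-1<..<1}. (deriv ^^ k) (jacobi_weight \<alpha> \<beta>) x = g k q x" for k
  proof (induction k)
    case 0
    show ?case by (rule exI[of _ 1]) (simp add: g_def jacobi_weight_def)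
  next
    case (Suc k)
    then obtain q where q: "\<And>x. x \<in> {-1<..<1} \<Longrightarrow> (deriv ^^ k) (jacobi_weight \<alpha> \<beta>) x = g k q x"
      by blast
    have "((deriv ^^ k) (jacobi_weight \<alpha> \<beta>) has_field_derivative g (Suc k) (d k q) x) (at x)"
      if "x \<in> {-1<..<1}" for x
      by (rule has_field_derivative_transform_within_open[OF g'[OF that], of "{-1<..<1}"])
         (use that q in auto)
    then have "\<forall>x\<in>{-1<..<1}. (deriv ^^ Suc k) (jacobi_weight \<alpha> \<beta>) x = g (Suc k) (d k q) x"
      by (simp add: DERIV_imp_deriv)
    then show ?case by blast
  qed
  show ?thesis
    unfolding smooth_on_open_def
  proof
    fix k
    obtain q where q: "\<And>x. x \<in> {-1<..<1} \<Longrightarrow> (deriv ^^ k) (jacobi_weight \<alpha> \<beta>) x = g k q x"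
      using * by blast
    have "((deriv ^^ k) (jacobi_weight \<alpha> \<beta>) has_field_derivative g (Suc k) (d k q) x) (at x)"
      if "x \<in> {-1<..<1}" for x
      by (rule has_field_derivative_transform_within_open[OF g'[OF that], of "{-1<..<1}"])
         (use that q in auto)
    then show "(deriv ^^ k) (jacobi_weight \<alpha> \<beta>) differentiable_on {-1<..<1}"
      by (blast intro: differentiable_at_imp_differentiable_on differentiableI
          has_field_derivative_imp_has_derivative)
  qed
qed

lemma scalar_weight_jacobi:
  assumes "\<alpha> > -1" "\<beta> > -1"
  shows "scalar_weight {-1<..<1} (jacobi_weight \<alpha> \<beta>)"
proof -
  have "integrable lborel (\<lambda>t. indicator {0..1} t *\<^sub>R (t powr \<beta> * (1 - t) powr \<alpha>))"
    using integrable_Beta[of "\<beta> + 1" "\<alpha> + 1"] assms by (simp add: set_integrable_def)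
  from lborel_integrable_real_affine[OF this, of "1/2" "1/2"]
  have "integrable lborel (\<lambda>x. 2 powr (\<alpha> + \<beta>) * (indicator {0..1} (1/2 + 1/2 * x) *\<^sub>R
      ((1/2 + 1/2 * x) powr \<beta> * (1 - (1/2 + 1/2 * x)) powr \<alpha>)))"
    by simp
  also have "(\<lambda>x. 2 powr (\<alpha> + \<beta>) * (indicator {0..1} (1/2 + 1/2 * x) *\<^sub>R
      ((1/2 + 1/2 * x) powr \<beta> * (1 - (1/2 + 1/2 * x)) powr \<alpha>)))
    = (\<lambda>x. indicator {-1..1} x *\<^sub>R jacobi_weight \<alpha> \<beta> x)"
  proof
    fix x :: real
    show "2 powr (\<alpha> + \<beta>) * (indicator {0..1} (1/2 + 1/2 * x) *\<^sub>R
        ((1/2 + 1/2 * x) powr \<beta> * (1 - (1/2 + 1/2 * x)) powr \<alpha>))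
      = indicator {-1..1} x *\<^sub>R jacobi_weight \<alpha> \<beta> x"
    proof (cases "x \<in> {-1..1}")
      case True
      have "1/2 + 1/2 * x = (1 + x) / 2" "1 - (1/2 + 1/2 * x) = (1 - x) / 2"
        by (simp_all add: field_simps)
      then show ?thesis
        using True by (simp add: jacobi_weight_def powr_divide powr_add field_simps)
    qed (auto simp: indicator_def)
  qed
  finally have "set_integrable lborel {-1..1} (jacobi_weight \<alpha> \<beta>)"
    by (simp add: set_integrable_def)
  then have int: "set_integrable lborel {-1<..<1} (jacobi_weight \<alpha> \<beta>)"
    by (rule set_integrable_subset) auto
  have "set_integrable lborel {-1<..<1} (\<lambda>x. x ^ n * jacobi_weight \<alpha> \<beta> x)" for n
  proof (rule set_integrable_bound[OF int])
    show "set_borel_measurable lborel {-1<..<1} (\<lambda>x. x ^ n * jacobi_weight \<alpha> \<beta> x)"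
      unfolding set_borel_measurable_def jacobi_weight_def by measurable
    have "\<bar>x\<bar> ^ n \<le> 1" if "x \<in> {-1<..<1}" for x :: real
      using that by (intro power_le_one) auto
    then show "AE x in lborel. x \<in> {-1<..<1} \<longrightarrow>
        norm (x ^ n * jacobi_weight \<alpha> \<beta> x) \<le> norm (jacobi_weight \<alpha> \<beta> x)"
      by (intro AE_I2) (auto simp: abs_mult power_abs intro!: mult_left_le_one_le)
  qed
  then show ?thesis
    by (auto simp: scalar_weight_def smooth_jacobi_weight jacobi_weight_def is_interval_oo)
qed

end

theory Submission
  imports Defs
begin

text \<open>
  For \<open>a, b > -1\<close> the monic orthogonal polynomials \<open>p_n\<close> of the weight
  \<open>(1 - x) powr a * (1 + x) powr b\<close> are the monic eigenpolynomials of the operator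
  \<open>\<delta> = (1 - x\<^sup>2) \<partial>\<^sup>2 + (b - a - (a + b + 2) x) \<partial>\<close>, with pairwise distinct eigenvalues
  \<open>-n (n + a + b + 1)\<close> (\<open>monic_ops_jacobi\<close>). This turns statements about the polynomials into identities
  between operators. Write \<open>\<delta>'\<close> and \<open>p'_n\<close> for the operator and the polynomials with
  parameters \<open>(c, d)\<close>. If \<open>a + b = c + d\<close>, the eigenvalues agree, and mapping every \<open>p_n\<close> to a multiple of
  \<open>p'_n\<close> is the same as intertwining, \<open>\<delta> V = V \<delta>'\<close>.

  If \<open>a + b = c + d\<close> and \<open>c - a\<close> is an integer, intertwiners in both directions are products of the first-order
  operators \<open>b + (1 + x) d/dx\<close> and \<open>a + (x - 1) d/dx\<close>, which shift the parameters by \<open>(1, -1)\<close> and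
  \<open>(-1, 1)\<close> (\<open>ex_intertwiner\<close>). All parameters met on the way are admissible, which is
  what makes every factor degree-preserving.

  For the converse, let \<open>\<delta> V = V \<delta>'\<close> with \<open>V\<close> of order \<open>m\<close> and leading coefficient \<open>v\<close>. The coefficient of
  order \<open>m + 1\<close> gives a first-order differential equation for \<open>v\<close> with a singular point at \<open>x = 1\<close>, and
  its indicial equation there reads \<open>c - a = m - 2 i\<close> for the multiplicity \<open>i\<close> of the zero of \<open>v\<close> at
  \<open>1\<close> (\<open>intertwiner_exponent\<close>). So \<open>c - a\<close> is an integer once \<open>V\<close> is known to intertwine, that is,
  once \<open>a + b = c + d\<close>.

  The equality of the sums comes from the eigenvalues \<open>\<Lambda>_n\<close> of \<open>D = V N\<close> on \<open>p_n\<close>, which are also those of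
  \<open>N V\<close> on \<open>p'_n\<close>. The exponent formula, now for \<open>c = a\<close>, shows that an operator commuting with \<open>\<delta>\<close> has
  even order and, by induction on the order, is a polynomial in \<open>\<delta>\<close>
  (\<open>jacobi_commutant_eigenvalues\<close>). Hence \<open>\<Lambda>_n\<close> is a polynomial in \<open>n (n + a + b + 1)\<close> and also in
  \<open>n (n + c + d + 1)\<close>. If the sums differ, the two reflection symmetries of these expressions compose to
  a translation, and \<open>\<Lambda>_n\<close> is constant (\<open>two_symmetries_imp_constant\<close>). Then \<open>V\<close> is a constant and the two
  families of polynomials coincide, which those of degrees one and two already contradict
  (\<open>common_eigenpolys_imp_sum_eq\<close>).
\<close>

section \<open>The right action of differential operators\<close>

lemma op_act_add_left: "op_act (p + q) D = op_act p D + op_act q D"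
  by (simp add: op_act_def higher_pderiv_add algebra_simps sum.distrib)

lemma op_act_smult_left: "op_act (smult c p) D = smult c (op_act p D)"
proof -
  have "smult c q = [:c:] * q" for q by simp
  then show ?thesis
    unfolding op_act_def higher_pderiv_smult by (simp only: sum_distrib_left mult.assoc)
qed

lemma op_act_diff_left: "op_act (p - q) D = op_act p D - op_act q D"
  using op_act_add_left[of "p - q" q D] by simp

lemma op_act_smult: "op_act p (smult f D) = op_act p D * f"
proof -
  have "op_act p (smult f D) = (\<Sum>j\<le>degree D. (pderiv ^^ j) p * coeff (smult f D) j)"
    by (rule op_act_bound) (rule degree_smult_le)
  also have "\<dots> = op_act p D * f"
    by (simp add: op_act_def sum_distrib_left mult_ac)
  finally show ?thesis .
qed

lemma op_act_diff: "op_act p (D - E) = op_act p D - op_act p E"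
  using op_act_add[of p "D - E" E] by simp

lemma op_act_const: "op_act p [:f:] = p * f"
  by (simp add: op_act_def)

text \<open>
  The action is faithful: if \<open>j\<close> is the least index of a nonzero coefficient \<open>f_j\<close>, then
  \<open>D\<close> sends \<open>x ^ j\<close> to \<open>j! f_j\<close>, since higher derivatives of \<open>x ^ j\<close> vanish.
\<close>

lemma op_eq_0I:
  assumes "\<And>p. op_act p D = 0"
  shows "D = 0"
proof -
  have "coeff D j = 0" for j
  proof (induction j rule: less_induct)
    case IH: (less j)
    define n where "n = max j (degree D)"
    have "0 = op_act (monom 1 j) D" using assms by simp
    also have "\<dots> = (\<Sum>i\<le>n. (pderiv ^^ i) (monom 1 j) * coeff D i)"
      by (rule op_act_bound) (simp add: n_def)
    also have "\<dots> = (\<Sum>i\<le>n. if i = j then (pderiv ^^ j) (monom 1 j) * coeff D j else 0)"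
    proof (rule sum.cong[OF refl])
      fix i
      show "(pderiv ^^ i) (monom 1 j) * coeff D i =
          (if i = j then (pderiv ^^ j) (monom 1 j) * coeff D j else 0)"
      proof (cases i j rule: linorder_cases)
        case less
        then show ?thesis using IH by simp
      next
        case greater
        then have "(pderiv ^^ i) (monom (1 :: complex) j) = 0"
          by (simp add: poly_eq_iff coeff_higher_pderiv)
        then show ?thesis using greater by simp
      qed simp
    qed
    also have "\<dots> = (pderiv ^^ j) (monom 1 j) * coeff D j"
      by (simp add: n_def)
    finally have "(pderiv ^^ j) (monom 1 j) * coeff D j = 0" by simp
    moreover have "coeff ((pderiv ^^ j) (monom (1 :: complex) j)) 0 \<noteq> 0"
      by (simp add: coeff_higher_pderiv pochhammer_fact[symmetric])
    ultimately show ?case by auto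
  qed
  then show ?thesis by (simp add: poly_eq_iff)
qed

lemma op_eqI:
  assumes "\<And>p. op_act p D = op_act p E"
  shows "D = E"
  using op_eq_0I[of "D - E"] assms by (simp add: op_act_diff)

text \<open>
  A sequence with one polynomial of each degree is a basis, so identities between operators need only
  be tested on orthogonal polynomials.
\<close>

lemma op_eqI_basis:
  assumes p: "\<And>n. degree (p n) = n" "\<And>n. p n \<noteq> 0"
    and eq: "\<And>n. op_act (p n) D = op_act (p n) E"
  shows "D = E"
proof (rule op_eqI)
  fix q
  have "\<forall>i\<ge>n. coeff q i = 0 \<Longrightarrow> op_act q D = op_act q E" for n
  proof (induction n arbitrary: q)
    case 0
    then have "q = 0" by (simp add: poly_eq_iff)
    then show ?case using op_act_smult_left[of 0] by simp
  next
    case (Suc n)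
    define c where "c = coeff q n / lead_coeff (p n)"
    define r where "r = q - smult c (p n)"
    have "coeff r i = 0" if "i \<ge> n" for i
      using Suc.prems that p[of n] leading_coeff_0_iff[of "p n"]
      by (cases "i = n") (auto simp: r_def c_def coeff_eq_0)
    then have "op_act r D = op_act r E" using Suc.IH by blast
    moreover have "q = r + smult c (p n)" by (simp add: r_def)
    ultimately show ?case using eq by (simp add: op_act_add_left op_act_smult_left)
  qed
  from this[of "Suc (degree q)"] show "op_act q D = op_act q E"
    by (simp add: coeff_eq_0)
qed

lemma coeff_op_mult:
  "coeff (op_mult D E) r =
     (\<Sum>i\<le>degree D. \<Sum>j\<le>degree E. \<Sum>k\<le>j.
        if i + k = r then of_nat (j choose k) * (pderiv ^^ (j - k)) (coeff D i) * coeff E j else 0)"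
  by (simp add: op_mult_def coeff_sum)

text \<open>
  Only the term with all derivatives falling on the argument reaches the top order, so leading
  coefficients multiply although the product is not commutative.
\<close>

lemma op_mult_top:
  "coeff (op_mult D E) (degree D + degree E) = lead_coeff D * lead_coeff E"
proof -
  have *: "(\<Sum>k\<le>j. if i + k = degree D + degree E
        then of_nat (j choose k) * (pderiv ^^ (j - k)) (coeff D i) * coeff E j else 0) =
      (if i = degree D \<and> j = degree E then lead_coeff D * lead_coeff E else 0)"
    if "i \<le> degree D" "j \<le> degree E" for i j
  proof (cases "i = degree D \<and> j = degree E")
    case True
    then have "(\<Sum>k\<le>j. if i + k = degree D + degree E
        then of_nat (j choose k) * (pderiv ^^ (j - k)) (coeff D i) * coeff E j else 0) =
        (\<Sum>k\<le>j. if k = j then lead_coeff D * lead_coeff E else 0)"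
      by (intro sum.cong) auto
    then show ?thesis using True by simp
  next
    case False
    then show ?thesis using that by (intro trans[OF sum.neutral]) auto
  qed
  have "coeff (op_mult D E) (degree D + degree E) =
     (\<Sum>i\<le>degree D. \<Sum>j\<le>degree E.
        if i = degree D \<and> j = degree E then lead_coeff D * lead_coeff E else 0)"
    unfolding coeff_op_mult by (intro sum.cong refl *) auto
  also have "\<dots> = (\<Sum>i\<le>degree D. if i = degree D then lead_coeff D * lead_coeff E else 0)"
    by (intro sum.cong refl) auto
  finally show ?thesis by simp
qed

lemma degree_op_mult_le: "degree (op_mult D E) \<le> degree D + degree E"
  by (rule degree_le) (auto simp: coeff_op_mult intro!: sum.neutral)

lemma
  assumes "D \<noteq> 0" "E \<noteq> 0"
  shows degree_op_mult: "degree (op_mult D E) = degree D + degree E"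
    and lead_coeff_op_mult: "lead_coeff (op_mult D E) = lead_coeff D * lead_coeff E"
proof -
  have "coeff (op_mult D E) (degree D + degree E) \<noteq> 0"
    using assms by (simp add: op_mult_top)
  then show d: "degree (op_mult D E) = degree D + degree E"
    by (intro antisym degree_op_mult_le le_degree)
  show "lead_coeff (op_mult D E) = lead_coeff D * lead_coeff E"
    by (simp add: d op_mult_top)
qed

section \<open>Eigenpolynomials of the Jacobi operator\<close>

abbreviation jacobi_quad :: "complex poly" where "jacobi_quad \<equiv> [:1, 0, -1:]"
abbreviation jacobi_lin :: "real \<Rightarrow> real \<Rightarrow> complex poly" where
  "jacobi_lin a b \<equiv> [:of_real (b - a), - of_real (a + b + 2):]"

text \<open>
  The hypergeometric operator \<open>(1 - x\<^sup>2) \<partial>\<^sup>2 + (b - a - (a + b + 2) x) \<partial>\<close>,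
  whose eigenpolynomials are the Jacobi polynomials.
\<close>

definition jacobi_op :: "real \<Rightarrow> real \<Rightarrow> diff_op" where
  "jacobi_op a b = [:0, jacobi_lin a b, jacobi_quad:]"

definition jacobi_eigenvalue :: "real \<Rightarrow> real \<Rightarrow> nat \<Rightarrow> real" where
  "jacobi_eigenvalue a b n = - (real n * (real n + a + b + 1))"

lemma op_act_jacobi_op:
  "op_act p (jacobi_op a b) = pderiv p * jacobi_lin a b + pderiv (pderiv p) * jacobi_quad"
proof -
  have "op_act p (jacobi_op a b) = (\<Sum>j\<le>2. (pderiv ^^ j) p * coeff (jacobi_op a b) j)"
    by (rule op_act_bound) (auto simp: jacobi_op_def intro: degree_le)
  then show ?thesis by (simp add: jacobi_op_def numeral_2_eq_2)
qed

text \<open>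
  In the monomial basis the operator is upper triangular with the eigenvalues on the diagonal.
\<close>

lemma coeff_jacobi_act:
  "coeff (op_act p (jacobi_op a b)) n = of_real (jacobi_eigenvalue a b n) * coeff p n
     + of_nat (Suc n) * of_real (b - a) * coeff p (Suc n)
     + of_nat (Suc n) * of_nat (Suc (Suc n)) * coeff p (Suc (Suc n))"
proof -
  have "coeff (q * [:u, v, w:]) n = u * coeff q n + v * (if n \<ge> 1 then coeff q (n - 1) else 0)
      + w * (if n \<ge> 2 then coeff q (n - 2) else 0)" for q and u v w :: complex
    by (cases n; cases "n - 1")
       (auto simp: mult.commute[of q] coeff_pCons numeral_2_eq_2 split: nat.splits)
  note c = this
  have c1: "coeff (q * [:u, v:]) n = u * coeff q n + v * (if n \<ge> 1 then coeff q (n - 1) else 0)"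
    for q and u v :: complex
    using c[of q u v 0] by simp
  show ?thesis
    unfolding op_act_jacobi_op coeff_add c c1 coeff_pderiv jacobi_eigenvalue_def
    by (cases n; cases "n - 1") (auto simp: algebra_simps numeral_2_eq_2)
qed

lemma eigenvalue_diff:
  "jacobi_eigenvalue a b m - jacobi_eigenvalue a b n = (real n - real m) * (real n + real m + a + b + 1)"
  by (simp add: jacobi_eigenvalue_def algebra_simps)

text \<open>
  The restriction \<open>a, b > -1\<close> enters through \<open>a + b + 1 > -1\<close>: it makes the second factor of
  \<open>(n - m) (n + m + a + b + 1)\<close> positive for distinct indices.
\<close>

lemma inj_jacobi_eigenvalue:
  assumes "a > -1" "b > -1"
  shows "jacobi_eigenvalue a b m = jacobi_eigenvalue a b n \<longleftrightarrow> m = n"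
proof -
  have "real n + real m + a + b + 1 > 0" if "m \<noteq> n"
  proof -
    have "m + n \<ge> 1" using that by simp
    then have "real n + real m \<ge> 1" by linarith
    then show ?thesis using assms by linarith
  qed
  then show ?thesis using eigenvalue_diff[of a b m n] by (cases "m = n") auto
qed

definition jacobi_eigenpoly :: "real \<Rightarrow> real \<Rightarrow> nat \<Rightarrow> complex poly \<Rightarrow> bool" where
  "jacobi_eigenpoly a b n p \<longleftrightarrow>
     op_act p (jacobi_op a b) = smult (of_real (jacobi_eigenvalue a b n)) p"

lemma jacobi_eigenpoly_smult: "jacobi_eigenpoly a b n p \<Longrightarrow> jacobi_eigenpoly a b n (smult c p)"
  by (simp add: jacobi_eigenpoly_def op_act_smult_left mult.commute)

lemma jacobi_eigenpoly_diff:
  "jacobi_eigenpoly a b n p \<Longrightarrow> jacobi_eigenpoly a b n q \<Longrightarrow> jacobi_eigenpoly a b n (p - q)"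
  by (simp add: jacobi_eigenpoly_def op_act_diff_left smult_diff_right)

lemma degree_jacobi_eigenpoly:
  assumes "a > -1" "b > -1" "jacobi_eigenpoly a b n p" "p \<noteq> 0"
  shows "degree p = n"
proof -
  have "coeff (op_act p (jacobi_op a b)) (degree p) =
      of_real (jacobi_eigenvalue a b (degree p)) * lead_coeff p"
    by (simp add: coeff_jacobi_act coeff_eq_0)
  also have "coeff (op_act p (jacobi_op a b)) (degree p) =
      of_real (jacobi_eigenvalue a b n) * lead_coeff p"
    using assms(3) by (simp add: jacobi_eigenpoly_def)
  finally show ?thesis
    using assms inj_jacobi_eigenvalue[of a b n "degree p"] by simp
qed

lemma jacobi_eigenpoly_multiple:
  assumes "a > -1" "b > -1" "jacobi_eigenpoly a b n p" "degree p = n" "coeff p n = 1"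
    and "jacobi_eigenpoly a b n q"
  shows "q = smult (coeff q n) p"
proof (rule ccontr)
  assume "q \<noteq> smult (coeff q n) p"
  moreover have "jacobi_eigenpoly a b n (q - smult (coeff q n) p)"
    using assms by (intro jacobi_eigenpoly_diff jacobi_eigenpoly_smult)
  ultimately have "degree (q - smult (coeff q n) p) = n" "q - smult (coeff q n) p \<noteq> 0"
    using degree_jacobi_eigenpoly[OF assms(1,2)] by auto
  moreover have "coeff (q - smult (coeff q n) p) n = 0"
    using assms by simp
  ultimately show False using leading_coeff_0_iff by metis
qed

text \<open>
  Below degree \<open>n\<close> the triangular operator minus its \<open>n\<close>-th eigenvalue has nonzero diagonal
  entries, hence is invertible there; back substitution removes one top coefficient at a time.
  The correction of \<open>x ^ n\<close> to an eigenpolynomial is obtained this way.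
\<close>

lemma jacobi_solve_below:
  assumes ab: "a > -1" "b > -1" and "m \<le> n" and g: "\<And>i. i \<ge> m \<Longrightarrow> coeff g i = 0"
  shows "\<exists>h. (\<forall>i\<ge>m. coeff h i = 0) \<and>
    op_act h (jacobi_op a b) - smult (of_real (jacobi_eigenvalue a b n)) h = g"
  using assms(3) g
proof (induction m arbitrary: g)
  case 0
  then have "g = 0" by (simp add: poly_eq_iff)
  then show ?case using op_act_smult_left[of 0 0] by (intro exI[of _ 0]) simp
next
  case (Suc m)
  define l where "l k = (of_real (jacobi_eigenvalue a b k) :: complex)" for k
  define L where "L h = op_act h (jacobi_op a b) - smult (l n) h" for h
  have ne: "l m - l n \<noteq> 0"
    using inj_jacobi_eigenvalue[OF ab, of m n] Suc.prems(1) by (auto simp: l_def)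
  define t where "t = monom (coeff g m / (l m - l n)) m"
  have "coeff (g - L t) i = 0" if "i \<ge> m" for i
    using that Suc.prems(2)[of i] ne
    by (cases "i = m") (auto simp: L_def t_def coeff_jacobi_act l_def[symmetric] field_simps)
  with Suc.IH[of "g - L t"] Suc.prems(1) obtain h
    where h: "\<And>i. i \<ge> m \<Longrightarrow> coeff h i = 0" "L h = g - L t"
    unfolding L_def l_def by auto
  have "L (h + t) = g"
    using h(2) by (simp add: L_def op_act_add_left smult_add_right algebra_simps)
  moreover have "coeff (h + t) i = 0" if "i \<ge> Suc m" for i
    using that h(1)[of i] by (simp add: t_def)
  ultimately show ?case unfolding L_def l_def by blast
qed

lemma ex_jacobi_eigenpoly:
  assumes "a > -1" "b > -1"
  shows "\<exists>p. degree p = n \<and> coeff p n = 1 \<and> jacobi_eigenpoly a b n p"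
proof -
  define l where "l = (of_real (jacobi_eigenvalue a b n) :: complex)"
  define g where "g = smult l (monom 1 n) - op_act (monom 1 n) (jacobi_op a b)"
  have "coeff g i = 0" if "i \<ge> n" for i
    using that by (auto simp: g_def coeff_jacobi_act l_def)
  then obtain h where h: "\<And>i. i \<ge> n \<Longrightarrow> coeff h i = 0" "op_act h (jacobi_op a b) - smult l h = g"
    using jacobi_solve_below[OF assms order_refl, of n g] unfolding l_def by blast
  define p where "p = monom 1 n + h"
  have c: "coeff p n = 1" "\<And>i. i > n \<Longrightarrow> coeff p i = 0"
    using h(1) by (auto simp: p_def)
  then have "degree p = n"
    by (intro antisym degree_le le_degree) auto
  moreover have "jacobi_eigenpoly a b n p"
    using h(2) by (simp add: jacobi_eigenpoly_def p_def g_def op_act_add_left smult_add_right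
        l_def[symmetric] algebra_simps)
  ultimately show ?thesis using c by blast
qed

section \<open>Orthogonality of the eigenpolynomials\<close>

lemma has_vector_derivative_poly_of_real:
  "((\<lambda>x. poly p (of_real x :: complex)) has_vector_derivative poly (pderiv p) (of_real x)) (at x)"
proof -
  have "((of_real :: real \<Rightarrow> complex) has_vector_derivative 1) (at x)"
    using has_vector_derivative_of_real[OF DERIV_ident] by simp
  from field_vector_diff_chain_at[OF this poly_DERIV] show ?thesis
    by (simp add: comp_def)
qed

lemma set_integrable_poly_weight:
  assumes "scalar_weight I w"
  shows "set_integrable lborel I (\<lambda>x. poly p (of_real x) * (of_real (w x) :: complex))"
proof -
  have "set_integrable lborel I (\<lambda>x. \<Sum>i\<le>degree p. coeff p i * of_real (x ^ i * w x))"
    unfolding set_integrable_def scaleR_sum_right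
  proof (rule Bochner_Integration.integrable_sum)
    fix i
    have "set_integrable lborel I (\<lambda>x. of_real (x ^ i * w x) :: complex)"
    proof -
      have "integrable lborel (\<lambda>x. complex_of_real (indicat_real I x *\<^sub>R (x ^ i * w x)))"
        using assms unfolding scalar_weight_def set_integrable_def by (intro integrable_of_real) auto
      then show ?thesis by (simp add: set_integrable_def scaleR_conv_of_real)
    qed
    then have "set_integrable lborel I (\<lambda>x. coeff p i * of_real (x ^ i * w x))"
      by (intro set_integrable_mult_right) auto
    then show "integrable lborel (\<lambda>x. indicat_real I x *\<^sub>R (coeff p i * of_real (x ^ i * w x)))"
      by (simp add: set_integrable_def)
  qed
  then show ?thesis
    by (simp add: poly_altdef sum_distrib_right mult.assoc)
qed

text \<open>
  These limits make the boundary terms of the partial integration below vanish; the exponents there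
  are one larger than those of the weight, hence positive.
\<close>

lemma jacobi_weight_boundary:
  assumes "a > 0" "b > 0"
  shows "(jacobi_weight a b \<longlongrightarrow> 0) (at_right (-1))" "(jacobi_weight a b \<longlongrightarrow> 0) (at_left 1)"
proof -
  have "continuous_on {-1..1} (jacobi_weight a b)"
    unfolding jacobi_weight_def using assms
    by (intro continuous_intros continuous_on_powr') auto
  then have "(jacobi_weight a b \<longlongrightarrow> jacobi_weight a b x) (at x within {-1..1})"
    if "x \<in> {-1..1}" for x
    using that by (simp add: continuous_on_def)
  from this[of "-1"] this[of 1] assms
  show "(jacobi_weight a b \<longlongrightarrow> 0) (at_right (-1))" "(jacobi_weight a b \<longlongrightarrow> 0) (at_left 1)"
    by (simp_all add: jacobi_weight_def at_within_Icc_at_right at_within_Icc_at_left)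
qed

text \<open>
  Pearson's equation \<open>(\<phi> w)' = \<psi> w\<close> with \<open>\<phi> = 1 - x\<^sup>2\<close> and
  \<open>\<psi> = b - a - (a + b + 2) x\<close>; raising both exponents by one is multiplication by \<open>\<phi>\<close>.
\<close>

lemma has_real_derivative_jacobi_weight:
  assumes x: "x \<in> {-1<..<1}"
  shows "(jacobi_weight (a + 1) (b + 1) has_real_derivative
    (b - a - (a + b + 2) * x) * jacobi_weight a b x) (at x)"
proof -
  have e: "(1 - x) powr (a + 1) = (1 - x) * (1 - x) powr a" "(1 + x) powr (b + 1) = (1 + x) * (1 + x) powr b"
    using x by (simp_all add: powr_add)
  have "((\<lambda>x. (1 - x) powr (a + 1) * (1 + x) powr (b + 1)) has_real_derivative
      - (a + 1) * (1 - x) powr a * (1 + x) powr (b + 1)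
        + (1 - x) powr (a + 1) * ((b + 1) * (1 + x) powr b)) (at x)"
    by (rule derivative_eq_intros refl | use x in \<open>simp add: algebra_simps\<close>)+
  also have "- (a + 1) * (1 - x) powr a * (1 + x) powr (b + 1)
        + (1 - x) powr (a + 1) * ((b + 1) * (1 + x) powr b) =
      (b - a - (a + b + 2) * x) * jacobi_weight a b x"
    unfolding e by (simp add: jacobi_weight_def algebra_simps)
  finally show ?thesis by (simp add: jacobi_weight_def[abs_def])
qed

text \<open>
  By Pearson's equation, \<open>(p\<delta> q - p q\<delta>) w\<close> is the derivative of
  \<open>\<phi> w (p' q - p q')\<close>, which tends to \<open>0\<close> at both end points.
\<close>

lemma jacobi_op_symmetric:
  assumes "a > -1" "b > -1"
  shows "(LINT x:{-1<..<1}|lborel. poly (op_act p (jacobi_op a b) * q) (of_real x) * of_real (jacobi_weight a b x))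
       = (LINT x:{-1<..<1}|lborel. poly (p * op_act q (jacobi_op a b)) (of_real x) * of_real (jacobi_weight a b x))"
proof -
  let ?I = "{-1<..<1} :: real set"
  note int = set_integrable_poly_weight[OF scalar_weight_jacobi[OF assms]]
  define g where "g = op_act p (jacobi_op a b) * q - p * op_act q (jacobi_op a b)"
  define W where "W = pderiv p * q - p * pderiv q"
  define F where "F x = poly W (of_real x) * of_real (jacobi_weight (a + 1) (b + 1) x)" for x
  define f where "f x = poly g (of_real x) * of_real (jacobi_weight a b x)" for x
  have g: "g = pderiv W * [:1, 0, -1:] + W * [:of_real (b - a), - of_real (a + b + 2):]"
    unfolding g_def W_def op_act_jacobi_op pderiv_diff pderiv_mult by (simp only: algebra_simps)
  have "(LBINT x=ereal (-1)..ereal 1. f x) = 0 - 0"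
  proof (rule interval_integral_FTC_integrable)
    fix x assume "ereal (-1) < ereal x" "ereal x < ereal 1"
    then have x: "x \<in> ?I" by auto
    have w1: "jacobi_weight (a + 1) (b + 1) x = (1 - x\<^sup>2) * jacobi_weight a b x"
      using x by (simp add: jacobi_weight_def powr_add power2_eq_square algebra_simps)
    have "(F has_vector_derivative
        poly W (of_real x) * of_real ((b - a - (a + b + 2) * x) * jacobi_weight a b x)
        + poly (pderiv W) (of_real x) * of_real (jacobi_weight (a + 1) (b + 1) x)) (at x)"
      unfolding F_def
      by (intro has_vector_derivative_mult has_vector_derivative_poly_of_real
          has_vector_derivative_of_real has_real_derivative_jacobi_weight x)
    also have "poly W (of_real x) * of_real ((b - a - (a + b + 2) * x) * jacobi_weight a b x)
        + poly (pderiv W) (of_real x) * of_real (jacobi_weight (a + 1) (b + 1) x) = f x"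
      unfolding w1 f_def g by (simp add: algebra_simps power2_eq_square)
    finally show "(F has_vector_derivative f x) (at x)" .
    show "isCont f x"
      unfolding f_def jacobi_weight_def using x by (intro continuous_intros) auto
  next
    show "set_integrable lborel (einterval (ereal (-1)) (ereal 1)) f"
      using int[of g] by (simp add: f_def[abs_def])
  next
    have "continuous_on UNIV (\<lambda>x. poly W (of_real x))"
      by (intro continuous_intros)
    then have W: "((\<lambda>x. poly W (of_real x)) \<longlongrightarrow> poly W (of_real y)) (at y within S)" for y :: real and S
      by (metis UNIV_I continuous_on_def subset_UNIV tendsto_within_subset)
    note lim = tendsto_mult[OF W tendsto_of_real[OF jacobi_weight_boundary(1)]]
      tendsto_mult[OF W tendsto_of_real[OF jacobi_weight_boundary(2)]]
    show "((F \<circ> real_of_ereal) \<longlongrightarrow> 0) (at_right (ereal (-1)))"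
      "((F \<circ> real_of_ereal) \<longlongrightarrow> 0) (at_left (ereal 1))"
      using lim[of "a + 1" "b + 1"] assms
      unfolding ereal_tendsto_simps1 F_def[abs_def] by simp_all
  qed auto
  then have "(LINT x:?I|lborel. f x) = 0"
    by (simp add: interval_lebesgue_integral_def)
  also have "(LINT x:?I|lborel. f x) =
     (LINT x:?I|lborel. poly (op_act p (jacobi_op a b) * q) (of_real x) * of_real (jacobi_weight a b x))
       - (LINT x:?I|lborel. poly (p * op_act q (jacobi_op a b)) (of_real x) * of_real (jacobi_weight a b x))"
    unfolding f_def g_def poly_diff of_real_mult left_diff_distrib by (rule set_integral_diff(2)[OF int int])
  finally show ?thesis by simp
qed

lemma weight_inner_eq:
  "weight_inner I w p q = (LINT x:I|lborel. poly (p * map_poly cnj q) (of_real x) * of_real (w x))"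
  by (simp add: weight_inner_def)

lemma weight_inner_diff_left:
  assumes "scalar_weight I w"
  shows "weight_inner I w (p - q) r = weight_inner I w p r - weight_inner I w q r"
  unfolding weight_inner_eq
  using set_integral_diff(2)[OF set_integrable_poly_weight[OF assms, of "p * map_poly cnj r"]
      set_integrable_poly_weight[OF assms, of "q * map_poly cnj r"]]
  by (simp add: left_diff_distrib)

lemma weight_inner_smult_left:
  "weight_inner I w (smult c p) r = c * weight_inner I w p r"
  by (simp add: weight_inner_def mult.assoc)

lemma cnj_weight_inner: "cnj (weight_inner I w p q) = weight_inner I w q p"
  unfolding weight_inner_def set_lebesgue_integral_def
  by (subst Bochner_Integration.integral_cnj[symmetric], rule Bochner_Integration.integral_cong)
     (simp_all add: mult_ac scaleR_conv_of_real)

lemma map_poly_cnj_jacobi_act: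
  "map_poly cnj (op_act q (jacobi_op a b)) = op_act (map_poly cnj q) (jacobi_op a b)"
  by (rule poly_eqI) (simp add: coeff_map_poly coeff_jacobi_act)

text \<open>
  Eigenvectors of a symmetric operator for distinct real eigenvalues are orthogonal. The operator
  has real coefficients, so it commutes with the conjugation in the second argument.
\<close>

lemma jacobi_eigenpoly_orthogonal:
  assumes ab: "a > -1" "b > -1" and "jacobi_eigenpoly a b m p" "jacobi_eigenpoly a b n q" "m \<noteq> n"
  shows "weight_inner {-1<..<1} (jacobi_weight a b) p q = 0"
proof -
  let ?in = "weight_inner {-1<..<1} (jacobi_weight a b)"
  have "of_real (jacobi_eigenvalue a b m) * ?in p q = ?in (op_act p (jacobi_op a b)) q"
    using assms by (simp add: jacobi_eigenpoly_def weight_inner_smult_left)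
  also have "\<dots> = ?in p (op_act q (jacobi_op a b))"
    unfolding weight_inner_eq map_poly_cnj_jacobi_act by (rule jacobi_op_symmetric[OF ab])
  also have "\<dots> = cnj (?in (op_act q (jacobi_op a b)) p)"
    by (simp add: cnj_weight_inner)
  also have "\<dots> = of_real (jacobi_eigenvalue a b n) * ?in p q"
    using assms by (simp add: jacobi_eigenpoly_def weight_inner_smult_left cnj_weight_inner)
  finally show ?thesis
    using inj_jacobi_eigenvalue[OF ab, of m n] assms(5) by simp
qed

text \<open>
  A weight that is positive almost everywhere gives a definite form: the integrand can vanish
  almost everywhere only if the polynomial has infinitely many zeros.
\<close>

lemma weight_inner_self_eq_0:
  assumes "scalar_weight I w" "weight_inner I w p p = 0"
  shows "p = 0"
proof (rule ccontr)
  assume "p \<noteq> 0"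
  have w: "open I" "I \<noteq> {}" "AE x in lborel. x \<in> I \<longrightarrow> w x > 0"
    using assms(1) by (auto simp: scalar_weight_def)
  define f where "f x = indicat_real I x * ((cmod (poly p (of_real x)))\<^sup>2 * w x)" for x
  have eq: "complex_of_real (f x) = indicat_real I x *\<^sub>R (poly p (of_real x) * cnj (poly p (of_real x)) * of_real (w x))" for x
    by (simp add: f_def complex_norm_square[symmetric] scaleR_conv_of_real)
  have "integrable lborel (\<lambda>x. complex_of_real (f x))"
    using set_integrable_poly_weight[OF assms(1), of "p * map_poly cnj p"]
    by (simp add: set_integrable_def eq)
  then have int: "integrable lborel f" by (simp only: complex_of_real_integrable_eq)
  have "complex_of_real (integral\<^sup>L lborel f) = 0"
    using assms(2) unfolding weight_inner_def set_lebesgue_integral_def eq[symmetric]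
    by simp
  then have "integral\<^sup>L lborel f = 0" by simp
  moreover have "AE x in lborel. f x \<ge> 0"
    using w(3) by eventually_elim (auto simp: f_def indicator_def)
  ultimately have "AE x in lborel. f x = 0"
    using integral_nonneg_eq_0_iff_AE[OF int] by simp
  then have "AE x in lborel. x \<in> I \<longrightarrow> poly p (of_real x) = 0"
    using w(3) by eventually_elim (auto simp: f_def indicator_def)
  moreover have fin: "finite {x :: real. poly p (of_real x) = 0}"
    using finite_vimageI[OF poly_roots_finite[OF \<open>p \<noteq> 0\<close>], of "of_real :: real \<Rightarrow> complex"]
    by (simp add: vimage_def inj_on_def)
  then have "AE x in lborel. poly p (of_real x) \<noteq> 0"
    using finite_imp_null_set_lborel[OF fin] by (intro AE_I'[of "{x. poly p (of_real x) = 0}"]) auto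
  ultimately have "AE x in lborel. x \<notin> I"
    by eventually_elim auto
  then have "I \<in> null_sets lborel"
    using w(1) by (subst AE_iff_null_sets) auto
  then show False
    using w(1,2) open_not_negligible negligible_iff_null_sets null_sets_completionI by blast
qed

lemma is_monic_opsD:
  assumes "is_monic_ops I w p"
  shows "degree (p n) = n" "coeff (p n) n = 1" "m \<noteq> n \<Longrightarrow> weight_inner I w (p m) (p n) = 0"
  using assms unfolding is_monic_ops_def by metis+

lemma weight_inner_ops_below:
  assumes w: "scalar_weight I w" and p: "is_monic_ops I w p" and r: "\<And>i. i \<ge> n \<Longrightarrow> coeff r i = 0"
  shows "weight_inner I w r (p n) = 0"
proof -
  have "m \<le> n \<Longrightarrow> (\<And>i. i \<ge> m \<Longrightarrow> coeff r i = 0) \<Longrightarrow> weight_inner I w r (p n) = 0" for m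
  proof (induction m arbitrary: r)
    case 0
    then have "r = 0" by (simp add: poly_eq_iff)
    then show ?case by (simp add: weight_inner_def)
  next
    case (Suc m)
    have pm: "degree (p m) = m" "coeff (p m) m = 1" "weight_inner I w (p m) (p n) = 0"
      using is_monic_opsD[OF p] Suc.prems(1) by auto
    define r' where "r' = r - smult (coeff r m) (p m)"
    have "coeff r' i = 0" if "i \<ge> m" for i
      using that Suc.prems(2)[of i] pm(1,2) by (cases "i = m") (auto simp: r'_def coeff_eq_0)
    then have "weight_inner I w r' (p n) = 0"
      using Suc.IH[of r'] Suc.prems(1) by simp
    then show ?case
      using pm(3) by (simp add: r'_def weight_inner_diff_left[OF w] weight_inner_smult_left)
  qed
  from this[of n] show ?thesis using r by blast
qed

text \<open>
  The difference of two monic candidates has lower degree, so both of them, and hence the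
  difference itself, are orthogonal to it.
\<close>

lemma is_monic_ops_unique:
  assumes w: "scalar_weight I w" and p: "is_monic_ops I w p" and q: "is_monic_ops I w q"
  shows "p = q"
proof
  fix n
  define r where "r = p n - q n"
  note lc = is_monic_opsD(1,2)[OF p, of n] is_monic_opsD(1,2)[OF q, of n]
  have r: "coeff r i = 0" if "i \<ge> n" for i
    using that lc by (cases "i = n") (auto simp: r_def coeff_eq_0)
  have "weight_inner I w (p n) r = 0" "weight_inner I w (q n) r = 0"
    using weight_inner_ops_below[OF w p r] weight_inner_ops_below[OF w q r]
    by (metis cnj_weight_inner complex_cnj_zero)+
  then have "weight_inner I w r r = 0"
    by (simp add: r_def weight_inner_diff_left[OF w])
  then have "r = 0" by (rule weight_inner_self_eq_0[OF w])
  then show "p n = q n" by (simp add: r_def)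
qed

text \<open>
  This description carries the rest of the argument: all that follows about the monic orthogonal
  polynomials is read off from their being eigenpolynomials of the Jacobi operator.
\<close>

lemma monic_ops_jacobi:
  assumes ab: "a > -1" "b > -1"
  defines "P \<equiv> monic_ops {-1<..<1} (jacobi_weight a b)"
  shows "degree (P n) = n" "coeff (P n) n = 1" "jacobi_eigenpoly a b n (P n)"
proof -
  obtain J where J: "\<And>n. degree (J n) = n \<and> coeff (J n) n = 1 \<and> jacobi_eigenpoly a b n (J n)"
    using ex_jacobi_eigenpoly[OF ab] by metis
  then have "is_monic_ops {-1<..<1} (jacobi_weight a b) J"
    unfolding is_monic_ops_def using jacobi_eigenpoly_orthogonal[OF ab] by metis
  then have "P = J"
    unfolding P_def monic_ops_def
    using is_monic_ops_unique[OF scalar_weight_jacobi[OF ab]] by blast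
  then show "degree (P n) = n" "coeff (P n) n = 1" "jacobi_eigenpoly a b n (P n)"
    using J by auto
qed

section \<open>First-order shifts of the parameters\<close>

text \<open>
  With \<open>\<delta>\<close> and \<open>\<delta>'\<close> the Jacobi operators of parameters \<open>(a, b)\<close> and \<open>(c, d)\<close>, the condition makes
  \<open>V\<close> map each eigenspace of \<open>\<delta>\<close> into the eigenspace of \<open>\<delta>'\<close> for the same eigenvalue.
\<close>

definition intertwines :: "real \<Rightarrow> real \<Rightarrow> real \<Rightarrow> real \<Rightarrow> diff_op \<Rightarrow> bool" where
  "intertwines a b c d V \<longleftrightarrow> op_mult (jacobi_op a b) V = op_mult V (jacobi_op c d)"

lemma intertwines_act:
  "intertwines a b c d V \<Longrightarrow> op_act (op_act p (jacobi_op a b)) V = op_act (op_act p V) (jacobi_op c d)"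
  unfolding intertwines_def by (metis op_act_mult)

lemma intertwinesI:
  assumes "\<And>p. op_act (op_act p (jacobi_op a b)) V = op_act (op_act p V) (jacobi_op c d)"
  shows "intertwines a b c d V"
  unfolding intertwines_def using assms by (intro op_eqI) (simp add: op_act_mult)

lemma intertwines_op_mult:
  assumes "intertwines a b c d V" "intertwines c d e f W"
  shows "intertwines a b e f (op_mult V W)"
  by (rule intertwinesI) (simp add: op_act_mult intertwines_act[OF assms(1)] intertwines_act[OF assms(2)])

lemma degree_preserving_op_mult:
  "degree_preserving V \<Longrightarrow> degree_preserving W \<Longrightarrow> degree_preserving (op_mult V W)"
  by (simp add: degree_preserving_def op_act_mult)

lemma op_act_first_order: "op_act p [:f, g:] = p * f + pderiv p * g"
proof -
  have "op_act p [:f, g:] = (\<Sum>j\<le>1. (pderiv ^^ j) p * coeff [:f, g:] j)"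
    by (rule op_act_bound) auto
  then show ?thesis by simp
qed

text \<open>
  \<open>x ^ n\<close> is mapped to \<open>(n + c) x ^ n\<close> plus lower terms, and \<open>n + c > 0\<close>.
\<close>

lemma degree_preserving_first_order:
  assumes "c > 0"
  shows "degree_preserving [:[:of_real c:], [:e, 1:]:]"
  unfolding degree_preserving_def
proof (intro allI impI)
  fix p :: "complex poly" assume "p \<noteq> 0"
  define q where "q = op_act p [:[:of_real c:], [:e, 1:]:]"
  have q: "coeff q n = of_real (c + n) * coeff p n + e * of_nat (Suc n) * coeff p (Suc n)" for n
  proof -
    have "coeff (pderiv p * [:e, 1:]) n = e * coeff (pderiv p) n + of_nat n * coeff p n"
      by (cases n) (simp_all add: coeff_pderiv)
    then show ?thesis
      by (simp add: q_def op_act_first_order coeff_pderiv algebra_simps)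
  qed
  have "coeff q (degree p) = of_real (c + degree p) * lead_coeff p"
    by (simp add: q coeff_eq_0 del: of_real_add)
  moreover have "c + degree p \<noteq> 0" using assms by linarith
  ultimately have ne: "coeff q (degree p) \<noteq> 0"
    using \<open>p \<noteq> 0\<close> by (simp del: of_real_add)
  have "coeff q n = 0" if "n > degree p" for n
    using that by (simp add: q coeff_eq_0)
  with ne have "degree q = degree p"
    by (intro antisym degree_le le_degree) auto
  moreover have "q \<noteq> 0" using ne by auto
  ultimately show "op_act p [:[:of_real c:], [:e, 1:]:] \<noteq> 0 \<and>
      degree (op_act p [:[:of_real c:], [:e, 1:]:]) = degree p"
    by (simp add: q_def)
qed

text \<open>
  The operators \<open>b + (1 + x) d/dx\<close> here and \<open>a + (x - 1) d/dx\<close> below move the parameters by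
  \<open>(1, -1)\<close> and \<open>(-1, 1)\<close>. The first is \<open>p \<mapsto> (1 + x) powr (1 - b) * ((1 + x) powr b * p)'\<close>; the second is, up to
  sign, its mirror image under \<open>x \<mapsto> -x\<close>.
\<close>

lemma intertwines_raise: "intertwines a b (a + 1) (b - 1) [:[:of_real b:], [:1, 1:]:]"
proof (rule intertwinesI, rule poly_ext)
  fix p x
  show "poly (op_act (op_act p (jacobi_op a b)) [:[:of_real b:], [:1, 1:]:]) x =
      poly (op_act (op_act p [:[:of_real b:], [:1, 1:]:]) (jacobi_op (a + 1) (b - 1))) x"
    by (simp add: op_act_first_order op_act_jacobi_op pderiv_add pderiv_diff
        pderiv_minus pderiv_mult pderiv_smult pderiv_pCons)
       (simp add: algebra_simps)
qed

lemma intertwines_lower: "intertwines a b (a - 1) (b + 1) [:[:of_real a:], [:-1, 1:]:]"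
proof (rule intertwinesI, rule poly_ext)
  fix p x
  show "poly (op_act (op_act p (jacobi_op a b)) [:[:of_real a:], [:-1, 1:]:]) x =
      poly (op_act (op_act p [:[:of_real a:], [:-1, 1:]:]) (jacobi_op (a - 1) (b + 1))) x"
    by (simp add: op_act_first_order op_act_jacobi_op pderiv_add pderiv_diff
        pderiv_minus pderiv_mult pderiv_smult pderiv_pCons)
       (simp add: algebra_simps)
qed

text \<open>
  Each step satisfies the positivity needed for preserving degrees because the next pair of
  parameters is still admissible: a step up from \<open>(a + k, b - k)\<close> needs \<open>b - k > 0\<close>, which is
  \<open>b - Suc k > -1\<close>; a step down from \<open>(a + Suc k, b - Suc k)\<close> needs \<open>a + Suc k > 0\<close>.
\<close>

lemma ex_intertwiner_chain:
  assumes "a > -1" "b - real k > -1"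
  shows "(\<exists>V. degree_preserving V \<and> intertwines a b (a + real k) (b - real k) V) \<and>
    (\<exists>V. degree_preserving V \<and> intertwines (a + real k) (b - real k) a b V)"
  using assms(2)
proof (induction k)
  case 0
  have "degree_preserving [:1:] \<and> intertwines a b a b [:1:]"
    by (auto simp: degree_preserving_def op_act_const intro!: intertwinesI)
  then show ?case by auto
next
  case (Suc k)
  have e: "a + real k + 1 = a + real (Suc k)" "b - real k - 1 = b - real (Suc k)"
    "a + real (Suc k) - 1 = a + real k" "b - real (Suc k) + 1 = b - real k"
    by simp_all
  obtain V W where V: "degree_preserving V" "intertwines a b (a + real k) (b - real k) V"
    and W: "degree_preserving W" "intertwines (a + real k) (b - real k) a b W"
    using Suc.IH Suc.prems by auto
  have "degree_preserving [:[:of_real (b - real k):], [:1, 1:]:]"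
    "intertwines (a + real k) (b - real k) (a + real (Suc k)) (b - real (Suc k))
      [:[:of_real (b - real k):], [:1, 1:]:]"
    using intertwines_raise[of "a + real k" "b - real k"] Suc.prems unfolding e
    by (auto intro!: degree_preserving_first_order simp del: of_real_diff)
  with V have "\<exists>V. degree_preserving V \<and> intertwines a b (a + real (Suc k)) (b - real (Suc k)) V"
    using degree_preserving_op_mult intertwines_op_mult by blast
  moreover have "degree_preserving [:[:of_real (a + real (Suc k)):], [:-1, 1:]:]"
    "intertwines (a + real (Suc k)) (b - real (Suc k)) (a + real k) (b - real k)
      [:[:of_real (a + real (Suc k)):], [:-1, 1:]:]"
    using intertwines_lower[of "a + real (Suc k)" "b - real (Suc k)"] assms(1) unfolding e
    by (auto intro!: degree_preserving_first_order simp del: of_real_add)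
  with W have "\<exists>V. degree_preserving V \<and> intertwines (a + real (Suc k)) (b - real (Suc k)) a b V"
    using degree_preserving_op_mult intertwines_op_mult by blast
  ultimately show ?case by blast
qed

lemma ex_intertwiner:
  assumes "a > -1" "b > -1" "c > -1" "d > -1" "a + b = c + d" "c - a \<in> \<int>"
  shows "\<exists>V. degree_preserving V \<and> intertwines a b c d V"
proof -
  obtain k where "c - a = of_int k" using assms(6) by (auto elim: Ints_cases)
  show ?thesis
  proof (cases "k \<ge> 0")
    case True
    then have "c = a + real (nat k)" "d = b - real (nat k)"
      using \<open>c - a = of_int k\<close> assms(5) by (simp_all add: algebra_simps)
    then show ?thesis using ex_intertwiner_chain[of a b "nat k"] assms by simp
  next
    case False
    then have e: "c + real (nat (-k)) = a" "d - real (nat (-k)) = b"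
      using \<open>c - a = of_int k\<close> assms(5) by (simp_all add: algebra_simps)
    then show ?thesis using ex_intertwiner_chain[of c d "nat (-k)"] assms(2,3) unfolding e by simp
  qed
qed

lemma intertwined_monic_ops:
  assumes "a > -1" "b > -1" "c > -1" "d > -1" "a + b = c + d" "intertwines a b c d V"
  shows "\<exists>A. op_act (monic_ops {-1<..<1} (jacobi_weight a b) n) V =
    smult A (monic_ops {-1<..<1} (jacobi_weight c d) n)"
proof -
  let ?p = "monic_ops {-1<..<1} (jacobi_weight a b) n"
  have "jacobi_eigenvalue a b n = jacobi_eigenvalue c d n"
    using assms(5) by (simp add: jacobi_eigenvalue_def add.assoc)
  then have "jacobi_eigenpoly c d n (op_act ?p V)"
    using monic_ops_jacobi(3)[OF assms(1,2), of n] intertwines_act[OF assms(6), of ?p]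
    by (simp add: jacobi_eigenpoly_def op_act_smult_left)
  then show ?thesis
    using jacobi_eigenpoly_multiple[OF assms(3,4)] monic_ops_jacobi[OF assms(3,4), of n] by blast
qed

text \<open>
  Both factors of the Darboux factorization are intertwiners, in opposite directions.
\<close>

lemma darboux_transformation_jacobi:
  assumes ab: "a > -1" "b > -1" and cd: "c > -1" "d > -1" and s: "a + b = c + d" "c - a \<in> \<int>"
  shows "darboux_transformation {-1<..<1} (jacobi_weight a b) (jacobi_weight c d)"
proof -
  have s': "c + d = a + b" "a - c \<in> \<int>"
    using s Ints_minus[of "c - a"] by simp_all
  obtain V N where V: "degree_preserving V" "intertwines a b c d V"
    and N: "degree_preserving N" "intertwines c d a b N"
    using ex_intertwiner[OF ab cd s] ex_intertwiner[OF cd ab s'] by blast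
  have "op_mult V N \<in> op_algebra {-1<..<1} (jacobi_weight a b)"
    unfolding op_algebra_def
    using intertwined_monic_ops[OF ab ab refl intertwines_op_mult[OF V(2) N(2)]] by blast
  then show ?thesis
    unfolding darboux_transformation_def
    using scalar_weight_jacobi[OF ab] scalar_weight_jacobi[OF cd] V N
      intertwined_monic_ops[OF ab cd s(1) V(2)] by blast
qed

section \<open>The leading coefficient of an intertwiner\<close>

text \<open>
  This singles out one order in the triple sum defining \<open>op_mult\<close>.
\<close>

lemma sum_if_add_eq:
  "(\<Sum>k\<le>j. if i + k = r then g k else (0::'a::comm_monoid_add)) =
    (if i \<le> r \<and> r - i \<le> (j::nat) then g (r - i) else 0)"
proof (cases "i \<le> r")
  case True
  then have "(i + k = r) = (k = r - i)" for k by auto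
  then show ?thesis using True by simp
next
  case False
  then show ?thesis by (auto intro: sum.neutral)
qed

lemma jacobi_op_coeffs:
  "degree (jacobi_op a b) = 2" "coeff (jacobi_op a b) 0 = 0"
  "coeff (jacobi_op a b) (Suc 0) = jacobi_lin a b" "coeff (jacobi_op a b) 2 = jacobi_quad"
  by (simp_all add: jacobi_op_def numeral_2_eq_2)

text \<open>
  The comparison of \<open>\<delta> V\<close> and \<open>V \<delta>\<close>, with \<open>m\<close> the order of \<open>V\<close>. The highest order
  \<open>m + 2\<close> of both is \<open>(1 - x\<^sup>2)\<close> times the leading coefficient and carries no information, so order
  \<open>m + 1\<close> is the first at which they can differ; the coefficient below the leading one contributes
  equally to both.
\<close>

lemma coeff_jacobi_op_mult:
  fixes V :: diff_op
  defines "m \<equiv> degree V"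
  shows "coeff (op_mult (jacobi_op a b) V) (Suc m) =
    (if m = 0 then 0 else jacobi_quad * coeff V (m - 1))
      + of_nat m * pderiv jacobi_quad * coeff V m + jacobi_lin a b * coeff V m"
proof -
  have eq: "coeff (op_mult (jacobi_op a b) V) (Suc m) =
     (\<Sum>j\<le>m. if m \<le> j then of_nat (j choose m) * (pderiv ^^ (j - m)) (jacobi_lin a b) * coeff V j else 0)
     + (\<Sum>j\<le>m. if 1 \<le> m \<and> m - 1 \<le> j
          then of_nat (j choose (m - 1)) * (pderiv ^^ (j - (m - 1))) jacobi_quad * coeff V j else 0)"
    unfolding coeff_op_mult sum_if_add_eq jacobi_op_coeffs m_def[symmetric]
    by (simp add: numeral_2_eq_2 jacobi_op_coeffs(2-4)[unfolded numeral_2_eq_2] del: pderiv_pCons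
        cong: if_cong)
  have "(\<Sum>j\<le>m. if m \<le> j then of_nat (j choose m) * (pderiv ^^ (j - m)) (jacobi_lin a b) * coeff V j else 0)
      = (\<Sum>j\<le>m. if j = m then jacobi_lin a b * coeff V m else 0)"
    by (rule sum.cong) auto
  moreover have "(\<Sum>j\<le>m. if 1 \<le> m \<and> m - 1 \<le> j
          then of_nat (j choose (m - 1)) * (pderiv ^^ (j - (m - 1))) jacobi_quad * coeff V j else 0)
      = (if m = 0 then 0 else jacobi_quad * coeff V (m - 1)) + of_nat m * pderiv jacobi_quad * coeff V m"
  proof (cases m)
    case (Suc l)
    have "(\<Sum>j<l. if l \<le> j then of_nat (j choose l) * (pderiv ^^ (j - l)) jacobi_quad * coeff V j else 0) = 0"
      by (rule sum.neutral) auto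
    then show ?thesis
      using Suc by (simp add: lessThan_Suc_atMost[symmetric] Suc_diff_le del: pderiv_pCons)
  qed simp
  ultimately show ?thesis unfolding eq by simp
qed

lemma coeff_mult_jacobi_op:
  fixes V :: diff_op
  defines "m \<equiv> degree V"
  shows "coeff (op_mult V (jacobi_op a b)) (Suc m) =
    (if m = 0 then 0 else jacobi_quad * coeff V (m - 1))
      + 2 * jacobi_quad * pderiv (coeff V m) + jacobi_lin a b * coeff V m"
proof -
  define t where "t i = (\<Sum>j\<le>2. if i \<le> Suc m \<and> Suc m - i \<le> j
      then of_nat (j choose (Suc m - i)) * (pderiv ^^ (j - (Suc m - i))) (coeff V i) * coeff (jacobi_op a b) j
      else 0)" for i
  have eq: "coeff (op_mult V (jacobi_op a b)) (Suc m) = (\<Sum>i\<le>m. t i)"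
    unfolding coeff_op_mult sum_if_add_eq jacobi_op_coeffs m_def[symmetric] t_def ..
  have t: "t m = 2 * jacobi_quad * pderiv (coeff V m) + jacobi_lin a b * coeff V m"
    by (simp add: t_def numeral_2_eq_2 jacobi_op_coeffs(2-4)[unfolded numeral_2_eq_2] mult_ac
        del: mult_pCons_left mult_pCons_right)
  show ?thesis
  proof (cases m)
    case 0
    then show ?thesis using t eq by simp
  next
    case (Suc l)
    have "t i = 0" if "i < l" for i
      using that Suc by (auto simp: t_def intro!: sum.neutral)
    moreover have "t l = jacobi_quad * coeff V l"
      using Suc by (simp add: t_def numeral_2_eq_2 jacobi_op_coeffs(2-4)[unfolded numeral_2_eq_2]
          mult_ac del: mult_pCons_left mult_pCons_right)
    ultimately show ?thesis
      unfolding eq using Suc t by (simp add: lessThan_Suc_atMost[symmetric] del: mult_pCons_left mult_pCons_right)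
  qed
qed

text \<open>
  Comparing coefficients of order \<open>m + 1\<close> in \<open>\<delta> V = V \<delta>'\<close> gives a first-order differential
  equation for the leading coefficient of \<open>V\<close> alone.
\<close>

lemma intertwines_lead_coeff:
  assumes "intertwines a b c d V"
  shows "2 * jacobi_quad * pderiv (lead_coeff V) =
    (of_nat (degree V) * pderiv jacobi_quad + jacobi_lin a b - jacobi_lin c d) * lead_coeff V"
proof -
  have "coeff (op_mult (jacobi_op a b) V) (Suc (degree V)) = coeff (op_mult V (jacobi_op c d)) (Suc (degree V))"
    using assms by (simp add: intertwines_def)
  then have "of_nat (degree V) * pderiv jacobi_quad * lead_coeff V + jacobi_lin a b * lead_coeff V
      = 2 * jacobi_quad * pderiv (lead_coeff V) + jacobi_lin c d * lead_coeff V"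
    unfolding coeff_jacobi_op_mult coeff_mult_jacobi_op by (simp only: add.assoc add_left_cancel)
  then show ?thesis
    by (simp only: algebra_simps)
qed

lemma mult_pderiv_power: "p * pderiv (p ^ i) = of_nat i * pderiv p * (p :: complex poly) ^ i"
proof (cases i)
  case (Suc j)
  then show ?thesis
    unfolding Suc pderiv_power_Suc by (simp add: of_nat_poly mult_ac)
qed simp

text \<open>
  The indicial equation at \<open>x = 1\<close> of the equation above. If \<open>a + b = c + d\<close>, its solutions are
  constant multiples of \<open>(1 - x) powr i * (1 + x) powr j\<close> with \<open>i + j = m\<close> and \<open>j - i = c - a\<close>, and a solution
  can be a polynomial only for an integer \<open>i\<close>.
\<close>

lemma intertwiner_exponent:
  assumes "intertwines a b c d V" "V \<noteq> 0"
  shows "c - a = real (degree V) - 2 * real (order 1 (lead_coeff V))"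
proof -
  define v i where "v = lead_coeff V" and "i = order 1 v"
  have "v \<noteq> 0" using assms(2) by (simp add: v_def)
  from order_decomp[OF this, of 1] obtain r where r: "v = [:-1, 1:] ^ i * r" "\<not> [:-1, 1:] dvd r"
    unfolding i_def by auto
  have pd: "[:-1, 1:] * pderiv ([:-1, 1:] ^ i) = of_nat i * [:-1, 1 :: complex:] ^ i"
    by (simp only: mult_pderiv_power) (simp add: pderiv_pCons)
  \<comment> \<open>Split off the factor that vanishes at \<open>1\<close>, cancel \<open>(x - 1) ^ i\<close>, and evaluate at \<open>1\<close>.\<close>
  have q: "jacobi_quad = [:-1, 1:] * [:-1, -1:]" by simp
  have "jacobi_quad * pderiv v = [:-1, -1:] * ([:-1, 1:] * pderiv ([:-1, 1:] ^ i)) * r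
      + [:-1, 1:] ^ i * ([:-1, -1:] * [:-1, 1:] * pderiv r)"
    unfolding r(1) pderiv_mult q by (simp only: algebra_simps)
  also have "\<dots> = [:-1, 1:] ^ i * ([:-1, -1:] * (of_nat i * r + [:-1, 1:] * pderiv r))"
    unfolding pd by (simp only: algebra_simps)
  finally have *: "jacobi_quad * pderiv v =
      [:-1, 1:] ^ i * ([:-1, -1:] * (of_nat i * r + [:-1, 1:] * pderiv r))" .
  have "[:-1, 1:] ^ i * (2 * ([:-1, -1:] * (of_nat i * r + [:-1, 1:] * pderiv r)))
      = 2 * jacobi_quad * pderiv v"
    unfolding mult.assoc[of 2] * by (rule mult.left_commute)
  also have "\<dots> = (of_nat (degree V) * pderiv jacobi_quad + jacobi_lin a b - jacobi_lin c d) * v"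
    unfolding v_def by (rule intertwines_lead_coeff[OF assms(1)])
  also have "\<dots> = [:-1, 1:] ^ i *
      ((of_nat (degree V) * pderiv jacobi_quad + jacobi_lin a b - jacobi_lin c d) * r)"
    by (subst r(1)) (rule mult.left_commute)
  finally have "[:-1, 1:] ^ i * (2 * ([:-1, -1:] * (of_nat i * r + [:-1, 1:] * pderiv r))) =
      [:-1, 1:] ^ i * ((of_nat (degree V) * pderiv jacobi_quad + jacobi_lin a b - jacobi_lin c d) * r)" .
  then have "2 * ([:-1, -1:] * (of_nat i * r + [:-1, 1:] * pderiv r)) =
      (of_nat (degree V) * pderiv jacobi_quad + jacobi_lin a b - jacobi_lin c d) * r"
    by (subst (asm) mult_cancel_left) simp
  then have "poly (2 * ([:-1, -1:] * (of_nat i * r + [:-1, 1:] * pderiv r))) 1 =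
      poly ((of_nat (degree V) * pderiv jacobi_quad + jacobi_lin a b - jacobi_lin c d) * r) 1"
    by (rule arg_cong)
  then have "of_real (- 4 * real i) * poly r 1 = of_real (- 2 * real (degree V) - 2 * a + 2 * c) * poly r 1"
    by (simp add: pderiv_pCons algebra_simps)
  moreover have "poly r 1 \<noteq> 0" using r(2) by (simp add: poly_eq_0_iff_dvd)
  ultimately have "- 4 * real i = - 2 * real (degree V) - 2 * a + 2 * c"
    by (simp only: mult_cancel_right of_real_eq_iff) simp
  then show ?thesis by (simp add: i_def v_def)
qed

section \<open>Operators commuting with the Jacobi operator\<close>

text \<open>
  Comparing the coefficients of \<open>x ^ (d + 1)\<close>, where \<open>d\<close> is the degree of a solution, forces
  \<open>d = k\<close>; so the solution is determined by its coefficient at \<open>x ^ k\<close>.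
\<close>

lemma jacobi_quad_ode_unique:
  assumes "pderiv v * jacobi_quad = of_nat k * [:0, -1:] * v" "coeff v k = 0"
  shows "v = 0"
proof (rule ccontr)
  assume "v \<noteq> 0"
  define d where "d = degree v"
  have A: "coeff (pderiv v * jacobi_quad) (Suc d) = - of_nat d * coeff v d"
    by (cases d) (simp_all add: coeff_pderiv coeff_eq_0 d_def algebra_simps)
  have B: "coeff (of_nat k * [:0, -1:] * v) (Suc d) = - of_nat k * coeff v d"
    by (simp add: of_nat_poly)
  have "coeff v d \<noteq> 0" using \<open>v \<noteq> 0\<close> by (simp add: d_def)
  moreover have "- of_nat d * coeff v d = - of_nat k * coeff v d"
    using A B unfolding assms(1) by (rule trans[OF sym])
  ultimately have "d = k" by simp
  then show False using assms(2) \<open>coeff v d \<noteq> 0\<close> by simp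
qed

definition jacobi_op_power :: "real \<Rightarrow> real \<Rightarrow> nat \<Rightarrow> diff_op" where
  "jacobi_op_power a b i = (op_mult (jacobi_op a b) ^^ i) 1"

lemma jacobi_op_power_top:
  "degree (jacobi_op_power a b i) = 2 * i \<and> lead_coeff (jacobi_op_power a b i) = jacobi_quad ^ i"
proof (induction i)
  case 0
  show ?case by (simp add: jacobi_op_power_def)
next
  case (Suc i)
  then have "jacobi_op_power a b i \<noteq> 0" by auto
  moreover have "jacobi_op a b \<noteq> 0" by (simp add: jacobi_op_def)
  moreover have "jacobi_op_power a b (Suc i) = op_mult (jacobi_op a b) (jacobi_op_power a b i)"
    by (simp add: jacobi_op_power_def)
  moreover have "lead_coeff (jacobi_op a b) = jacobi_quad" by (simp add: jacobi_op_def)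
  ultimately show ?case
    using Suc degree_op_mult[of "jacobi_op a b" "jacobi_op_power a b i"]
      lead_coeff_op_mult[of "jacobi_op a b" "jacobi_op_power a b i"] jacobi_op_coeffs(1)[of a b]
    by (metis mult_Suc_right power_Suc)
qed

lemma op_act_jacobi_op_power:
  assumes "jacobi_eigenpoly a b n p"
  shows "op_act p (jacobi_op_power a b i) = smult (of_real (jacobi_eigenvalue a b n) ^ i) p"
proof (induction i)
  case 0
  show ?case using op_act_const[of p 1] by (simp add: jacobi_op_power_def one_pCons)
next
  case (Suc i)
  then show ?case
    using assms by (simp add: jacobi_op_power_def jacobi_eigenpoly_def op_act_mult op_act_smult_left)
qed

text \<open>
  Operators diagonal in the Jacobi polynomials are polynomials in the Jacobi operator. Such an operator
  \<open>D\<close> of order \<open>k\<close> commutes with \<open>\<delta>\<close>, so \<open>intertwiner_exponent\<close> with equal parameters shows that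
  \<open>k = 2 i\<close> is even, and the differential equation shows that the leading coefficient is a multiple of
  \<open>(1 - x\<^sup>2) ^ i\<close>, the leading coefficient of \<open>\<delta> ^ i\<close>. Subtracting that multiple of \<open>\<delta> ^ i\<close> lowers the
  order. Since odd orders are excluded, the eigenvalue of \<open>D\<close> on the \<open>n\<close>-th polynomial depends on
  \<open>n\<close> through \<open>n (n + a + b + 1)\<close> only.
\<close>

lemma jacobi_commutant_eigenvalues:
  assumes p: "\<And>n. degree (p n) = n" "\<And>n. coeff (p n) n = 1" "\<And>n. jacobi_eigenpoly a b n (p n)"
    and D: "\<And>n. op_act (p n) D = smult (\<Lambda> n) (p n)"
  shows "\<exists>F. \<forall>n. \<Lambda> n = poly F (of_real (jacobi_eigenvalue a b n))"
proof -
  have p0: "p n \<noteq> 0" for n using p(2)[of n] by auto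
  have "\<exists>F. \<forall>n. \<Lambda> n = poly F (of_real (jacobi_eigenvalue a b n))"
    if "\<And>j. j \<ge> k \<Longrightarrow> coeff D j = 0" "\<And>n. op_act (p n) D = smult (\<Lambda> n) (p n)" for k D \<Lambda>
    using that
  proof (induction k arbitrary: D \<Lambda>)
    case 0
    then have "D = 0" by (simp add: poly_eq_iff)
    then show ?case using 0(2) p0 by (intro exI[of _ 0]) auto
  next
    case (Suc k)
    show ?case
    proof (cases "coeff D k = 0")
      case True
      then have "coeff D j = 0" if "j \<ge> k" for j
        using that Suc.prems(1)[of j] by (cases "j = k") auto
      then show ?thesis using Suc.IH Suc.prems(2) by blast
    next
      case False
      then have deg: "degree D = k"
        using Suc.prems(1) by (intro antisym degree_le le_degree) auto
      define v where "v = lead_coeff D"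
      define i where "i = order 1 v"
      have "intertwines a b a b D"
        unfolding intertwines_def
      proof (rule op_eqI_basis[OF p(1) p0])
        fix n
        show "op_act (p n) (op_mult (jacobi_op a b) D) = op_act (p n) (op_mult D (jacobi_op a b))"
          using p(3)[of n] Suc.prems(2)[of n]
          by (simp add: jacobi_eigenpoly_def op_act_mult op_act_smult_left mult.commute)
      qed
      moreover have "D \<noteq> 0" using False by auto
      ultimately have "real k = 2 * real i"
          and v: "2 * jacobi_quad * pderiv v = of_nat k * pderiv jacobi_quad * v"
        using intertwiner_exponent[of a b a b D] intertwines_lead_coeff[of a b a b D] False
        unfolding v_def i_def deg by auto
      then have k: "k = 2 * i" by linarith
      have pq: "pderiv jacobi_quad = 2 * [:0, -1:]"
        by (simp add: pderiv_pCons numeral_poly)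
      have v: "pderiv v * jacobi_quad = of_nat k * [:0, -1:] * v"
      proof -
        have "2 * (pderiv v * jacobi_quad) = 2 * (of_nat k * [:0, -1:] * v)"
          using v unfolding pq by (simp only: mult_ac)
        then show ?thesis by (subst (asm) mult_cancel_left) simp
      qed
      have q: "pderiv (jacobi_quad ^ i) * jacobi_quad = of_nat k * [:0, -1:] * jacobi_quad ^ i"
        using mult_pderiv_power[of jacobi_quad i] unfolding pq k
        by (simp only: of_nat_mult of_nat_numeral mult_ac)
      have lq: "coeff (jacobi_quad ^ i) k = (-1) ^ i"
        using lead_coeff_power[of jacobi_quad i] by (simp add: degree_power_eq k mult_2 mult_2_right)
      define c where "c = coeff v k / (-1) ^ i"
      have "v - smult c (jacobi_quad ^ i) = 0"
      proof (rule jacobi_quad_ode_unique)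
        show "pderiv (v - smult c (jacobi_quad ^ i)) * jacobi_quad =
            of_nat k * [:0, -1:] * (v - smult c (jacobi_quad ^ i))"
          using v q by (simp add: pderiv_diff pderiv_smult left_diff_distrib right_diff_distrib
              del: mult_pCons_left mult_pCons_right)
        show "coeff (v - smult c (jacobi_quad ^ i)) k = 0"
          by (simp add: c_def lq)
      qed
      then have vc: "v = smult c (jacobi_quad ^ i)" by simp
      define D' where "D' = D - smult [:c:] (jacobi_op_power a b i)"
      define \<Lambda>' where "\<Lambda>' n = \<Lambda> n - c * of_real (jacobi_eigenvalue a b n) ^ i" for n
      have "coeff D' j = 0" if "j \<ge> k" for j
        using that vc Suc.prems(1)[of j] jacobi_op_power_top[of a b i] deg k
        by (cases "j = k") (auto simp: D'_def v_def coeff_eq_0)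
      moreover have "op_act (p n) D' = smult (\<Lambda>' n) (p n)" for n
        using Suc.prems(2)[of n] op_act_jacobi_op_power[OF p(3), of n i]
        by (simp add: D'_def \<Lambda>'_def op_act_diff op_act_smult smult_diff_left mult.commute)
      ultimately obtain F where "\<forall>n. \<Lambda>' n = poly F (of_real (jacobi_eigenvalue a b n))"
        using Suc.IH by blast
      then have "\<forall>n. \<Lambda> n = poly (F + monom c i) (of_real (jacobi_eigenvalue a b n))"
        by (auto simp: \<Lambda>'_def poly_monom algebra_simps)
      then show ?thesis by blast
    qed
  qed
  from this[of "Suc (degree D)" D \<Lambda>] D show ?thesis
    by (simp add: coeff_eq_0)
qed

section \<open>The parameter sum is determined by the eigenvalues\<close>

lemma poly_eqI_of_nat:
  fixes p q :: "complex poly"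
  assumes "\<And>n::nat. poly p (of_nat n) = poly q (of_nat n)"
  shows "p = q"
proof (rule ccontr)
  assume "p \<noteq> q"
  then have "finite {x. poly (p - q) x = 0}" by (intro poly_roots_finite) simp
  moreover have "range (of_nat :: nat \<Rightarrow> complex) \<subseteq> {x. poly (p - q) x = 0}"
    using assms by auto
  ultimately have "finite (range (of_nat :: nat \<Rightarrow> complex))" by (rule rev_finite_subset)
  then show False using finite_imageD[of "of_nat :: nat \<Rightarrow> complex" UNIV] by (simp add: inj_of_nat)
qed

lemma poly_const_of_periodic:
  fixes h :: "complex poly"
  assumes "t \<noteq> 0" "\<And>x. poly h (x + t) = poly h x"
  shows "poly h x = poly h y"
proof -
  have "poly h (x + of_nat n * t) = poly h x" for n x
  proof (induction n)
    case (Suc n)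
    then show ?case using assms(2)[of "x + of_nat n * t"] by (simp add: algebra_simps)
  qed simp
  then have "pcompose h [:x, t:] = [:poly h x:]"
    by (intro poly_eqI_of_nat) (simp add: poly_pcompose mult.commute)
  from arg_cong[OF this, of "\<lambda>p. poly p ((y - x) / t)"] assms(1) show ?thesis
    by (simp add: poly_pcompose)
qed

text \<open>
  A polynomial in \<open>x (x + a + b + 1)\<close> is invariant under the reflection
  \<open>x \<mapsto> -(a + b + 1) - x\<close>. Two such reflections compose to a translation, which is nontrivial if
  the sums differ, and only constant polynomials are periodic.
\<close>

lemma two_symmetries_imp_constant:
  fixes F G :: "complex poly"
  assumes FG: "\<And>n. poly F (of_real (jacobi_eigenvalue a b n)) = poly G (of_real (jacobi_eigenvalue c d n))"
    and "a + b \<noteq> c + d"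
  shows "poly F (of_real (jacobi_eigenvalue a b m)) = poly F (of_real (jacobi_eigenvalue a b n))"
proof -
  define l where "l a b = [:0, - of_real (a + b + 1), -1 :: complex:]" for a b
  have l: "of_real (jacobi_eigenvalue a b n) = poly (l a b) (of_nat n)" for a b n
    by (simp add: l_def jacobi_eigenvalue_def algebra_simps)
  have sym: "poly (l a b) (- of_real (a + b + 1) - x) = poly (l a b) x" for a b x
    by (simp add: l_def algebra_simps)
  define H where "H = pcompose F (l a b)"
  have HG: "H = pcompose G (l c d)"
    unfolding H_def using FG by (intro poly_eqI_of_nat) (simp add: poly_pcompose l)
  define t where "t = (of_real (c + d - (a + b)) :: complex)"
  have "poly H (x + t) = poly H x" for x
  proof -
    have "poly H (- of_real (a + b + 1) - (- of_real (c + d + 1) - x)) = poly H (- of_real (c + d + 1) - x)"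
      unfolding H_def poly_pcompose sym ..
    also have "\<dots> = poly H x"
      unfolding HG poly_pcompose sym ..
    finally show ?thesis by (simp add: t_def algebra_simps)
  qed
  moreover have "t \<noteq> 0" using assms(2) by (simp add: t_def del: of_real_add of_real_diff)
  ultimately have "poly H x = poly H y" for x y by (rule poly_const_of_periodic[rotated])
  from this[of "of_nat m" "of_nat n"] show ?thesis by (simp add: H_def poly_pcompose l)
qed

text \<open>
  Subtracting the two eigenvalue equations leaves a first-order operator. If the sums differ, it is a
  multiple of \<open>(x - x\<^sub>0) d/dx\<close>, where \<open>x\<^sub>0\<close> is the zero of the polynomial of degree one, and so that of degree two
  is \<open>(x - x\<^sub>0)\<^sup>2\<close>. The second-order equation for it at the double zero then gives \<open>1 - x\<^sub>0\<^sup>2 = 0\<close>.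
  But the polynomial of degree one does not vanish at an end point, because
  \<open>b - a - (a + b + 2) x\<close> takes there the values \<open>-2a - 2\<close> and \<open>2b + 2\<close>.
\<close>

lemma common_eigenpolys_imp_sum_eq:
  assumes ab: "a > -1" "b > -1"
    and p: "\<And>n. degree (p n) = n" "\<And>n. coeff (p n) n = 1"
    and e: "\<And>n. jacobi_eigenpoly a b n (p n)" "\<And>n. jacobi_eigenpoly c d n (p n)"
  shows "a + b = c + d"
proof (rule ccontr)
  assume ne: "a + b \<noteq> c + d"
  define x where "x = - coeff (p 1) 0"
  have p1: "p 1 = [:-x, 1:]"
  proof (rule poly_eqI)
    fix i show "coeff (p 1) i = coeff [:-x, 1:] i"
      using p[of 1] by (cases i; cases "i - 1") (auto simp: x_def coeff_eq_0)
  qed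
  define u v where "u = coeff (p 2) 0" and "v = coeff (p 2) 1"
  have p2: "p 2 = [:u, v, 1:]"
  proof (rule poly_eqI)
    fix i :: nat
    consider "i = 0" | "i = 1" | "i = 2" | "i > 2" by linarith
    then show "coeff (p 2) i = coeff [:u, v, 1:] i"
      using p[of 2] by cases (auto simp: u_def v_def coeff_eq_0 numeral_2_eq_2 coeff_pCons split: nat.splits)
  qed
  have E: "poly (op_act q (jacobi_op a' b')) y = of_real (jacobi_eigenvalue a' b' n) * poly q y"
    if "jacobi_eigenpoly a' b' n q" for a' b' n q y
    using that by (simp add: jacobi_eigenpoly_def)
  note A1 = E[OF e(1)[of 1, unfolded p1]] and C1 = E[OF e(2)[of 1, unfolded p1]]
    and A2 = E[OF e(1)[of 2, unfolded p2]] and C2 = E[OF e(2)[of 2, unfolded p2]]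
  note expand = op_act_jacobi_op jacobi_eigenvalue_def pderiv_pCons
  define s t where "s = (of_real (a + b) :: complex)" and "t = (of_real (c + d) :: complex)"
  define h k where "h = (of_real (b - a) :: complex)" and "k = (of_real (d - c) :: complex)"
  note defs = s_def t_def h_def k_def
  have "s \<noteq> t" using ne by (simp add: defs del: of_real_add)
  have h: "h = (s + 2) * x" using A1[of x] by (simp add: expand defs algebra_simps)
  have k: "k = (t + 2) * x" using C1[of x] by (simp add: expand defs algebra_simps)
  have A2': "2 * (1 - y\<^sup>2) + (h - (s + 2) * y) * (v + 2 * y) = - 2 * (s + 3) * (u + v * y + y\<^sup>2)" for y
    using A2[of y] by (simp add: expand defs power2_eq_square algebra_simps)
  have C2': "2 * (1 - y\<^sup>2) + (k - (t + 2) * y) * (v + 2 * y) = - 2 * (t + 3) * (u + v * y + y\<^sup>2)" for y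
    using C2[of y] by (simp add: expand defs power2_eq_square algebra_simps)
  have "(t - s) * ((y - x) * (v + 2 * y)) = (t - s) * (2 * (u + v * y + y\<^sup>2))" for y
    using A2'[of y] C2'[of y] unfolding h k by algebra
  then have r: "(y - x) * (v + 2 * y) = 2 * (u + v * y + y\<^sup>2)" for y
    using \<open>s \<noteq> t\<close> by simp
  have u: "u + v * x + x\<^sup>2 = 0" using r[of x] by algebra
  have "2 * u = - (x * v)" "(1 - x) * (v + 2) = 2 * u + 2 * v + 2"
    using r[of 0] r[of 1] by (simp_all add: algebra_simps)
  then have v: "v + 2 * x = 0" by algebra
  \<comment> \<open>\<open>u + v y + y\<^sup>2\<close> and its derivative vanish at \<open>x\<close>, so only the second-order term survives.\<close>
  have "2 * (1 - x\<^sup>2) = 0"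
    using A2'[of x] u v by simp
  then have "x = 1 \<or> x = -1" by (simp add: power2_eq_1_iff)
  then have "of_real (2 * a + 2) = (0 :: complex) \<or> of_real (2 * b + 2) = (0 :: complex)"
    using h by (auto simp: defs algebra_simps)
  then show False using ab by (simp only: of_real_eq_0_iff) linarith
qed

section \<open>Darboux transformations between Jacobi weights\<close>

text \<open>
  Exchanging the two factors of \<open>D = V N\<close> yields an operator diagonal in the other family with the
  same eigenvalues. Thus these depend polynomially on \<open>n (n + a + b + 1)\<close> as well as on
  \<open>n (n + c + d + 1)\<close>. Different sums would make them constant and the operators trivial; once the sums
  agree, so do the eigenvalues of the two Jacobi operators, and \<open>V\<close> intertwines them.
\<close>

lemma darboux_transformation_jacobi_imp:
  assumes ab: "a > -1" "b > -1" and cd: "c > -1" "d > -1"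
    and dt: "darboux_transformation {-1<..<1} (jacobi_weight a b) (jacobi_weight c d)"
  shows "a + b = c + d" "c - a \<in> \<int>"
proof -
  define p where "p = monic_ops {-1<..<1} (jacobi_weight a b)"
  define q where "q = monic_ops {-1<..<1} (jacobi_weight c d)"
  note p = monic_ops_jacobi[OF ab, folded p_def] and q = monic_ops_jacobi[OF cd, folded q_def]
  have p0: "p n \<noteq> 0" for n using p(2)[of n] by auto
  from dt obtain V N where DV: "op_mult V N \<in> op_algebra {-1<..<1} (jacobi_weight a b)"
    and V: "degree_preserving V" and N: "degree_preserving N"
    and AV: "\<And>n. \<exists>A. op_act (p n) V = smult A (q n)"
    unfolding darboux_transformation_def p_def q_def by blast
  obtain A where A: "\<And>n. op_act (p n) V = smult (A n) (q n)"
    using AV by metis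
  obtain \<Lambda> where D: "\<And>n. op_act (p n) (op_mult V N) = smult (\<Lambda> n) (p n)"
    using DV unfolding op_algebra_def mem_Collect_eq p_def[symmetric] by metis
  have A0: "A n \<noteq> 0" for n
  proof -
    have "op_act (p n) V \<noteq> 0" using V p0[of n] unfolding degree_preserving_def by blast
    then show ?thesis unfolding A by (metis smult_0_left)
  qed
  have "op_act (p 0) V \<noteq> 0" "op_act (p 0) N \<noteq> 0"
    using V N p0[of 0] unfolding degree_preserving_def by blast+
  then have V0: "V \<noteq> 0" and N0: "N \<noteq> 0" by (auto simp only: op_act_0)
  \<comment> \<open>\<open>N V\<close> has the same eigenvalues on the other family: apply \<open>V\<close> on the right of \<open>p_n V N\<close>.\<close>
  have D': "op_act (q n) (op_mult N V) = smult (\<Lambda> n) (q n)" for n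
  proof -
    have "smult (A n) (op_act (q n) (op_mult N V)) = op_act (op_act (op_act (p n) V) N) V"
      by (simp add: A op_act_smult_left op_act_mult)
    also have "\<dots> = op_act (smult (\<Lambda> n) (p n)) V"
      by (simp only: D[of n, unfolded op_act_mult])
    also have "\<dots> = smult (A n) (smult (\<Lambda> n) (q n))"
      by (simp add: op_act_smult_left A mult.commute)
    finally show ?thesis by (rule smult_cancel[OF A0])
  qed
  obtain F G where F: "\<And>n. \<Lambda> n = poly F (of_real (jacobi_eigenvalue a b n))"
    and G: "\<And>n. \<Lambda> n = poly G (of_real (jacobi_eigenvalue c d n))"
    using jacobi_commutant_eigenvalues[OF p D] jacobi_commutant_eigenvalues[OF q D'] by blast
  show sum: "a + b = c + d"
  proof (rule ccontr)
    assume ne: "a + b \<noteq> c + d"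
    have const: "\<Lambda> n = \<Lambda> 0" for n
      using two_symmetries_imp_constant[OF _ ne, of F G n 0] F G by simp
    have "op_mult V N = [:[:\<Lambda> 0:]:]"
    proof (rule op_eqI_basis[OF p(1) p0])
      show "op_act (p n) (op_mult V N) = op_act (p n) [:[:\<Lambda> 0:]:]" for n
        unfolding D const[of n] op_act_const by simp
    qed
    \<comment> \<open>The product has order zero, hence so has \<open>V\<close>, and both families agree up to scalars.\<close>
    then have "degree V + degree N = 0"
      using degree_op_mult[OF V0 N0] by simp
    then obtain f where f: "V = [:f:]" by (auto elim: degree_eq_zeroE)
    have "op_act 1 V \<noteq> 0 \<and> degree (op_act 1 V) = 0"
      using V unfolding degree_preserving_def by (metis degree_1 zero_neq_one)
    then obtain f0 where f0: "f = [:f0:]" "f0 \<noteq> 0"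
      unfolding f op_act_const by (auto elim: degree_eq_zeroE)
    have "q n = p n" for n
    proof -
      have e: "smult f0 (p n) = smult (A n) (q n)"
        using A[of n] by (simp add: f f0 op_act_const)
      from arg_cong[OF this, of "\<lambda>r. coeff r n"] have "f0 = A n"
        by (simp add: p(2) q(2))
      with e have "smult (A n) (q n) = smult (A n) (p n)" by simp
      then show ?thesis by (rule smult_cancel[OF A0])
    qed
    then show False
      using common_eigenpolys_imp_sum_eq[OF ab p, of c d] q(3) ne by simp
  qed
  have "intertwines a b c d V"
    unfolding intertwines_def
  proof (rule op_eqI_basis[OF p(1) p0])
    fix n
    have "jacobi_eigenvalue a b n = jacobi_eigenvalue c d n"
      using sum by (simp add: jacobi_eigenvalue_def add.assoc)
    then show "op_act (p n) (op_mult (jacobi_op a b) V) = op_act (p n) (op_mult V (jacobi_op c d))"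
      using p(3)[of n] q(3)[of n]
      by (simp add: jacobi_eigenpoly_def op_act_mult op_act_smult_left A mult.commute)
  qed
  from intertwiner_exponent[OF this V0] show "c - a \<in> \<int>" by simp
qed

theorem theorem5p4:
  fixes \<alpha> \<beta> \<alpha>' \<beta>' :: real
  assumes "\<alpha> > -1" and "\<beta> > -1" and "\<alpha>' > -1" and "\<beta>' > -1"
  shows "darboux_transformation {-1<..<1} (jacobi_weight \<alpha>' \<beta>') (jacobi_weight \<alpha> \<beta>) \<longleftrightarrow>
    \<alpha> + \<beta> = \<alpha>' + \<beta>' \<and> \<alpha> - \<alpha>' \<in> \<int>"
  using darboux_transformation_jacobi[OF assms(3,4,1,2)]
    darboux_transformation_jacobi_imp[OF assms(3,4,1,2)] by auto

end
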